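(* Let $\Gamma$ be a finite graph. The component $L_0(\Gamma)$ of the space $L(\Gamma)$ of dimer labelings of $\Gamma$ is homeomorphic to the dimer complex of $\Gamma$. All other components of $L(\Gamma)$ are homeomorphic to the dimer complexes of certain subgraphs of $\Gamma$.
   Context: A graph is a 1-dimensional CW-complex without loops (multiple edges are allowed); finite means finitely many vertices and edges. Let $E$ be the set of edges of $\Gamma$. The power group $G=2^E$ is the set of subsets of $E$ with multiplication $AB=(A\cup B)\setminus(A\cap B)$. A dimer covering is a set of edges such that every vertex of $\Gamma$ is incident to exactly one edge in the set; $\mathcal{D}\subset G$ is the set of dimer coverings. A dimer labeling of $\Gamma$ is a labeling of the edges by non-negative real numbers such that for every vertex the labels of the incident edges sum up to $1$ and only one or two of these labels may be non-zero; the set $L(\Gamma)\subset[0,1]^E$ of dimer labelings has the induced topology. The characteristic functions of dimer coverings are dimer labelings, and they all lie in a single path-connected component of $L(\Gamma)$, denoted $L_0(\Gamma)$ ($L_0(\Gamma)=\emptyset$ if there are no dimer coverings). Subgraphs may be empty; the empty graph has exactly one dimer covering (the empty set) and one dimer labeling. Dimer complex: a set $s\subset E$ is cyclic if it is finite and each vertex of $\Gamma$ is either incident to exactly two distinct edges belonging to $s$ or not incident to any edge belonging to $s$. A cyclic set is a cycle if the union of its edges is a single circle; a cycle is even if it has an even number of elements. Two sets of edges $s,t$ are independent if no edge in $s$ has a common vertex with an edge in $t$. For a finite set $S$ of pairwise independent even cycles, put $[S]=\prod_{s\in S}s\in G$, $[\emptyset]=\emptyset$. A based cube is a pair $(A,S)$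 with $A\in G$ and $S$ a finite set of pairwise independent even cycles; its vertices are the elements $[T]A$, $T\subset S$. Based cubes $(A,S)$ and $([T]A,S)$ with $T\subset S$ are equivalent; equivalence classes are called cubes in $G$. The cubed complex $X_G$ consists of triples $(A,S,x)$ with $(A,S)$ a based cube and $x:S\to[0,1]$, modulo the equivalence relation generated by: $(A,S,x)\sim(A,S',x')$ if $S\subset S'$, $x=x'|_S$, $x'(S'\setminus S)=0$; and $(A,S,x)\sim([T]A,S,x')$ if $T\subset S$, $x'=x$ on $S\setminus T$, $x'(t)=1-x(t)$ for $t\in T$. The dimer complex $X_{\mathcal{D}}\subset X_G$ of $\Gamma$ is the subcomplex formed by the cubes all of whose vertices lie in $\mathcal{D}$. *)

theory Defs
  imports "HOL-Analysis.Analysis" "HOL-Algebra.FiniteProduct"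
begin

text \<open>A one-dimensional CW-complex without loops is encoded by its vertices, its edges, and the map
  sending an edge to the pair of its distinct endpoints.  Parallel edges are allowed, since edges
  are names rather than pairs of vertices.  The value of \<open>ends\<close> outside \<open>edges\<close> is irrelevant.\<close>

record ('v, 'e) mgraph =
  verts :: "'v set"
  edges :: "'e set"
  ends :: "'e \<Rightarrow> 'v set"

definition mgraph :: "('v, 'e) mgraph \<Rightarrow> bool" where
  "mgraph \<Gamma> \<longleftrightarrow> (\<forall>e\<in>edges \<Gamma>. ends \<Gamma> e \<subseteq> verts \<Gamma> \<and> card (ends \<Gamma> e) = 2)"

definition finite_mgraph :: "('v, 'e) mgraph \<Rightarrow> bool" where
  "finite_mgraph \<Gamma> \<longleftrightarrow> mgraph \<Gamma> \<and> finite (verts \<Gamma>) \<and> finite (edges \<Gamma>)"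

definition subgraph :: "('v, 'e) mgraph \<Rightarrow> ('v, 'e) mgraph \<Rightarrow> bool" where
  "subgraph \<Gamma>' \<Gamma> \<longleftrightarrow>
     mgraph \<Gamma>' \<and> mgraph \<Gamma> \<and> verts \<Gamma>' \<subseteq> verts \<Gamma> \<and> edges \<Gamma>' \<subseteq> edges \<Gamma> \<and>
     (\<forall>e\<in>edges \<Gamma>'. ends \<Gamma>' e = ends \<Gamma> e)"

definition incident :: "('v, 'e) mgraph \<Rightarrow> 'v \<Rightarrow> 'e set \<Rightarrow> 'e set" where
  "incident \<Gamma> v s = {e \<in> s. v \<in> ends \<Gamma> e}"

definition dimer_covering :: "('v, 'e) mgraph \<Rightarrow> 'e set \<Rightarrow> bool" where
  "dimer_covering \<Gamma> D \<longleftrightarrow> D \<subseteq> edges \<Gamma> \<and> (\<forall>v\<in>verts \<Gamma>. card (incident \<Gamma> v D) = 1)"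

definition dimer_coverings :: "('v, 'e) mgraph \<Rightarrow> 'e set set" where
  "dimer_coverings \<Gamma> = {D. dimer_covering \<Gamma> D}"

text \<open>Labelings are extensional functions on the set of edges, as in the library's product topology.\<close>

definition dimer_labelings :: "('v, 'e) mgraph \<Rightarrow> ('e \<Rightarrow> real) set" where
  "dimer_labelings \<Gamma> = {l \<in> edges \<Gamma> \<rightarrow>\<^sub>E {0..}. \<forall>v\<in>verts \<Gamma>.
     (\<Sum>e\<in>incident \<Gamma> v (edges \<Gamma>). l e) = 1 \<and>
     card {e \<in> incident \<Gamma> v (edges \<Gamma>). l e \<noteq> 0} \<in> {1, 2}}"

definition labeling_space :: "('v, 'e) mgraph \<Rightarrow> ('e \<Rightarrow> real) topology" where
  "labeling_space \<Gamma> =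
     subtopology (product_topology (\<lambda>_. top_of_set {0..1}) (edges \<Gamma>)) (dimer_labelings \<Gamma>)"

definition char_labeling :: "('v, 'e) mgraph \<Rightarrow> 'e set \<Rightarrow> 'e \<Rightarrow> real" where
  "char_labeling \<Gamma> D = (\<lambda>e\<in>edges \<Gamma>. indicator D e)"

text \<open>The description below determines the component uniquely, see \<open>labeling_space0_unique\<close>.\<close>

definition labeling_space0 :: "('v, 'e) mgraph \<Rightarrow> ('e \<Rightarrow> real) set" where
  "labeling_space0 \<Gamma> =
     (if dimer_coverings \<Gamma> = {} then {}
      else THE C. C \<in> path_components_of (labeling_space \<Gamma>) \<and>
                  (\<forall>D\<in>dimer_coverings \<Gamma>. char_labeling \<Gamma> D \<in> C))"

definition power_group :: "('v, 'e) mgraph \<Rightarrow> 'e set monoid" where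
  "power_group \<Gamma> = \<lparr>carrier = Pow (edges \<Gamma>), mult = (\<lambda>A B. (A \<union> B) - (A \<inter> B)), one = {}\<rparr>"

definition cyclic_set :: "('v, 'e) mgraph \<Rightarrow> 'e set \<Rightarrow> bool" where
  "cyclic_set \<Gamma> s \<longleftrightarrow>
     s \<subseteq> edges \<Gamma> \<and> finite s \<and> (\<forall>v\<in>verts \<Gamma>. card (incident \<Gamma> v s) = 2 \<or> incident \<Gamma> v s = {})"

text \<open>The edges of \<open>s\<close> form a polygon with \<open>n \<ge> 2\<close> distinct corners and \<open>n\<close> distinct sides;
  for \<open>n = 2\<close> these are two parallel edges.\<close>

definition forms_circle :: "('v, 'e) mgraph \<Rightarrow> 'e set \<Rightarrow> bool" where
  "forms_circle \<Gamma> s \<longleftrightarrow> (\<exists>n vs es. n \<ge> 2 \<and> length vs = n \<and> length es = n \<and>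
     distinct vs \<and> distinct es \<and> set es = s \<and>
     (\<forall>i<n. ends \<Gamma> (es ! i) = {vs ! i, vs ! (Suc i mod n)}))"

definition cycle :: "('v, 'e) mgraph \<Rightarrow> 'e set \<Rightarrow> bool" where
  "cycle \<Gamma> s \<longleftrightarrow> cyclic_set \<Gamma> s \<and> forms_circle \<Gamma> s"

definition even_cycle :: "('v, 'e) mgraph \<Rightarrow> 'e set \<Rightarrow> bool" where
  "even_cycle \<Gamma> s \<longleftrightarrow> cycle \<Gamma> s \<and> even (card s)"

definition independent_edges :: "('v, 'e) mgraph \<Rightarrow> 'e set \<Rightarrow> 'e set \<Rightarrow> bool" where
  "independent_edges \<Gamma> s t \<longleftrightarrow> (\<forall>e\<in>s. \<forall>f\<in>t. ends \<Gamma> e \<inter> ends \<Gamma> f = {})"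

definition based_cubes :: "('v, 'e) mgraph \<Rightarrow> ('e set \<times> 'e set set) set" where
  "based_cubes \<Gamma> = {(A, S). A \<in> carrier (power_group \<Gamma>) \<and> finite S \<and>
     (\<forall>s\<in>S. even_cycle \<Gamma> s) \<and> pairwise (independent_edges \<Gamma>) S}"

definition slide :: "('v, 'e) mgraph \<Rightarrow> 'e set set \<Rightarrow> 'e set \<Rightarrow> 'e set" where
  "slide \<Gamma> T A = finprod (power_group \<Gamma>) (\<lambda>s. s) T \<otimes>\<^bsub>power_group \<Gamma>\<^esub> A"

definition cube_vertices :: "('v, 'e) mgraph \<Rightarrow> 'e set \<times> 'e set set \<Rightarrow> 'e set set" where
  "cube_vertices \<Gamma> = (\<lambda>(A, S). {slide \<Gamma> T A | T. T \<subseteq> S})"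

text \<open>The triple \<open>(A, S, x)\<close> is written \<open>((A, S), x)\<close>: it is a point of the disjoint union, over all
  based cubes \<open>(A, S)\<close>, of the geometric cubes \<open>[0,1]\<^sup>S\<close>.\<close>

definition cube_sum :: "('v, 'e) mgraph \<Rightarrow>
    (('e set \<times> 'e set set) \<times> ('e set \<Rightarrow> real)) topology" where
  "cube_sum \<Gamma> =
     sum_topology (\<lambda>(A, S). product_topology (\<lambda>_. top_of_set {0..1}) S) (based_cubes \<Gamma>)"

inductive cube_glue :: "('v, 'e) mgraph \<Rightarrow> ('e set \<times> 'e set set) \<times> ('e set \<Rightarrow> real) \<Rightarrow>
    ('e set \<times> 'e set set) \<times> ('e set \<Rightarrow> real) \<Rightarrow> bool" for \<Gamma> where
  face: "\<lbrakk>((A, S), x) \<in> topspace (cube_sum \<Gamma>); ((A, S'), x') \<in> topspace (cube_sum \<Gamma>);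
          S \<subseteq> S'; x = restrict x' S; \<forall>s\<in>S' - S. x' s = 0\<rbrakk>
         \<Longrightarrow> cube_glue \<Gamma> ((A, S), x) ((A, S'), x')"
| rebase: "\<lbrakk>((A, S), x) \<in> topspace (cube_sum \<Gamma>);
            ((slide \<Gamma> T A, S), x') \<in> topspace (cube_sum \<Gamma>);
            T \<subseteq> S; \<forall>s\<in>S - T. x' s = x s; \<forall>t\<in>T. x' t = 1 - x t\<rbrakk>
           \<Longrightarrow> cube_glue \<Gamma> ((A, S), x) ((slide \<Gamma> T A, S), x')"

text \<open>\<open>equivclp\<close> is the generated equivalence relation; it identifies points of \<open>cube_sum\<close> only with
  points of \<open>cube_sum\<close>, since \<open>cube_glue\<close> does.\<close>

definition cube_class :: "('v, 'e) mgraph \<Rightarrow> ('e set \<times> 'e set set) \<times> ('e set \<Rightarrow> real) \<Rightarrow>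
    (('e set \<times> 'e set set) \<times> ('e set \<Rightarrow> real)) set" where
  "cube_class \<Gamma> p = {q. equivclp (cube_glue \<Gamma>) p q}"

definition quotient_topology :: "'a topology \<Rightarrow> ('a \<Rightarrow> 'b) \<Rightarrow> 'b topology" where
  "quotient_topology X f =
     topology (\<lambda>U. U \<subseteq> f ` topspace X \<and> openin X {x \<in> topspace X. f x \<in> U})"

definition cubed_complex :: "('v, 'e) mgraph \<Rightarrow>
    (('e set \<times> 'e set set) \<times> ('e set \<Rightarrow> real)) set topology" where
  "cubed_complex \<Gamma> = quotient_topology (cube_sum \<Gamma>) (cube_class \<Gamma>)"

definition dimer_complex :: "('v, 'e) mgraph \<Rightarrow>
    (('e set \<times> 'e set set) \<times> ('e set \<Rightarrow> real)) set topology" where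
  "dimer_complex \<Gamma> = subtopology (cubed_complex \<Gamma>)
     {cube_class \<Gamma> (c, x) | c x. (c, x) \<in> topspace (cube_sum \<Gamma>) \<and>
                                cube_vertices \<Gamma> c \<subseteq> dimer_coverings \<Gamma>}"

lemma openin_quotient_topology:
  "openin (quotient_topology X f) U \<longleftrightarrow>
     U \<subseteq> f ` topspace X \<and> openin X {x \<in> topspace X. f x \<in> U}"
proof -
  have 1: "{x \<in> topspace X. f x \<in> S \<inter> T} = {x \<in> topspace X. f x \<in> S} \<inter> {x \<in> topspace X. f x \<in> T}"
    for S T by auto
  have 2: "{x \<in> topspace X. f x \<in> \<Union>K} = (\<Union>U\<in>K. {x \<in> topspace X. f x \<in> U})" for K
    by auto
  have "istopology (\<lambda>U. U \<subseteq> f ` topspace X \<and> openin X {x \<in> topspace X. f x \<in> U})"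
    unfolding istopology_def 1 2 by blast
  then show ?thesis
    by (simp add: quotient_topology_def)
qed

lemma topspace_quotient_topology [simp]: "topspace (quotient_topology X f) = f ` topspace X"
proof (rule antisym)
  show "topspace (quotient_topology X f) \<subseteq> f ` topspace X"
    using openin_quotient_topology[of X f "topspace (quotient_topology X f)"] by auto
  have "{x \<in> topspace X. f x \<in> f ` topspace X} = topspace X" by auto
  then have "openin (quotient_topology X f) (f ` topspace X)"
    by (simp add: openin_quotient_topology)
  then show "f ` topspace X \<subseteq> topspace (quotient_topology X f)"
    by (rule openin_subset)
qed

lemma quotient_map_quotient_topology: "quotient_map X (quotient_topology X f) f"
  by (auto simp: quotient_map_def openin_quotient_topology)

lemma comm_group_power_group: "comm_group (power_group \<Gamma>)"
  by (rule comm_groupI) (auto simp: power_group_def)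

lemma equivclp_cube_glue_topspace:
  assumes "equivclp (cube_glue \<Gamma>) p q" "p \<in> topspace (cube_sum \<Gamma>)"
  shows "q \<in> topspace (cube_sum \<Gamma>)"
  using assms by (induction rule: equivclp_induct) (auto elim!: cube_glue.cases)

lemma char_segment_in_labeling_space:
  assumes fin: "finite_mgraph \<Gamma>" and D: "D \<in> dimer_coverings \<Gamma>" "D' \<in> dimer_coverings \<Gamma>"
    and t: "t \<in> {0..1::real}"
  shows "(\<lambda>e\<in>edges \<Gamma>. (1 - t) * indicator D e + t * indicator D' e)
           \<in> topspace (labeling_space \<Gamma>)" (is "?g \<in> _")
proof -
  have g01: "?g e \<in> {0..1}" if "e \<in> edges \<Gamma>" for e
    using that t by (auto simp: indicator_def)
  have vertex: "(\<Sum>e\<in>incident \<Gamma> v (edges \<Gamma>). ?g e) = 1 \<and>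
      card {e \<in> incident \<Gamma> v (edges \<Gamma>). ?g e \<noteq> 0} \<in> {1, 2}" if v: "v \<in> verts \<Gamma>" for v
  proof -
    let ?I = "incident \<Gamma> v (edges \<Gamma>)"
    have finI: "finite ?I"
      using fin by (simp add: finite_mgraph_def incident_def)
    obtain d where d: "incident \<Gamma> v D = {d}"
      using D(1) v unfolding dimer_coverings_def dimer_covering_def by (auto simp: card_1_singleton_iff)
    obtain d' where d': "incident \<Gamma> v D' = {d'}"
      using D(2) v unfolding dimer_coverings_def dimer_covering_def by (auto simp: card_1_singleton_iff)
    have sub: "D \<subseteq> edges \<Gamma>" "D' \<subseteq> edges \<Gamma>"
      using D by (auto simp: dimer_coverings_def dimer_covering_def)
    have dI: "?I \<inter> D = {d}" and dI': "?I \<inter> D' = {d'}"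
      using d d' sub by (auto simp: incident_def)
    have sum_ind: "(\<Sum>e\<in>?I. indicator B e) = real (card (?I \<inter> B))" for B
      using finI sum.inter_restrict[of ?I "\<lambda>_. 1::real" B]
      by (simp add: indicator_def of_bool_def)
    have sumD: "(\<Sum>e\<in>?I. indicator D e) = (1::real)" and sumD': "(\<Sum>e\<in>?I. indicator D' e) = (1::real)"
      using sum_ind[of D] sum_ind[of D'] dI dI' by simp_all
    have "(\<Sum>e\<in>?I. ?g e) = (\<Sum>e\<in>?I. (1 - t) * indicator D e + t * indicator D' e)"
      by (rule sum.cong) (auto simp: incident_def)
    also have "\<dots> = 1"
      by (simp add: sum.distrib sumD sumD' flip: sum_distrib_left)
    finally have sum1: "(\<Sum>e\<in>?I. ?g e) = 1" .
    let ?N = "{e \<in> ?I. ?g e \<noteq> 0}"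
    have "?N \<subseteq> {d, d'}"
      using dI dI' by (auto simp: indicator_def incident_def split: if_splits)
    then have "card ?N \<le> 2"
      using card_mono[of "{d, d'}" ?N] card_insert_le_m1[of 2 "{d'}" d] by simp
    moreover have "?N \<noteq> {}"
    proof
      assume "?N = {}"
      then have "(\<Sum>e\<in>?I. ?g e) = 0"
        by (intro sum.neutral) blast
      with sum1 show False by simp
    qed
    then have "card ?N \<noteq> 0"
      using finI by simp
    ultimately have "card ?N = 1 \<or> card ?N = 2"
      by linarith
    then have "card ?N \<in> {1, 2}"
      by blast
    with sum1 show ?thesis by blast
  qed
  have "?g \<in> dimer_labelings \<Gamma>"
    unfolding dimer_labelings_def using g01 vertex by (auto simp: PiE_iff)
  moreover have "?g \<in> topspace (product_topology (\<lambda>_. top_of_set {0..1}) (edges \<Gamma>))"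
    using g01 by (auto simp: PiE_iff)
  ultimately show ?thesis
    by (simp add: labeling_space_def)
qed

lemma path_component_char_labeling:
  assumes "finite_mgraph \<Gamma>" "D \<in> dimer_coverings \<Gamma>" "D' \<in> dimer_coverings \<Gamma>"
  shows "path_component_of (labeling_space \<Gamma>) (char_labeling \<Gamma> D) (char_labeling \<Gamma> D')"
proof -
  define g where "g = (\<lambda>t::real. \<lambda>e\<in>edges \<Gamma>. (1 - t) * indicator D e + t * indicator D' e)"
  have mem: "g t \<in> topspace (labeling_space \<Gamma>)" if "t \<in> {0..1}" for t
    using char_segment_in_labeling_space[OF assms that] by (simp add: g_def)
  have "continuous_map (top_of_set {0..1})
      (product_topology (\<lambda>_. top_of_set {0..1::real}) (edges \<Gamma>)) g"
    unfolding continuous_map_componentwise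
  proof (intro conjI ballI)
    show "g ` topspace (top_of_set {0..1}) \<subseteq> extensional (edges \<Gamma>)"
      by (auto simp: g_def)
    fix e assume e: "e \<in> edges \<Gamma>"
    have "continuous_on {0..1} (\<lambda>t. g t e)"
      using e by (auto simp: g_def intro!: continuous_intros)
    moreover have "g t e \<in> {0..1}" if "t \<in> {0..1}" for t
      using e that by (auto simp: g_def indicator_def)
    ultimately show "continuous_map (top_of_set {0..1}) (top_of_set {0..1}) (\<lambda>t. g t e)"
      by auto
  qed
  then have "pathin (labeling_space \<Gamma>) g"
    using mem by (auto simp: pathin_def labeling_space_def continuous_map_in_subtopology)
  moreover have "g 0 = char_labeling \<Gamma> D" "g 1 = char_labeling \<Gamma> D'"
    by (auto simp: g_def char_labeling_def)
  ultimately show ?thesis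
    unfolding path_component_of_def by blast
qed

lemma labeling_space0_unique:
  assumes "finite_mgraph \<Gamma>" "dimer_coverings \<Gamma> \<noteq> {}"
  shows "\<exists>!C. C \<in> path_components_of (labeling_space \<Gamma>) \<and>
              (\<forall>D\<in>dimer_coverings \<Gamma>. char_labeling \<Gamma> D \<in> C)"
proof -
  obtain D where D: "D \<in> dimer_coverings \<Gamma>"
    using assms(2) by blast
  let ?C = "Collect (path_component_of (labeling_space \<Gamma>) (char_labeling \<Gamma> D))"
  show ?thesis
  proof (rule ex1I[of _ ?C], intro conjI ballI)
    show "?C \<in> path_components_of (labeling_space \<Gamma>)"
      using path_component_char_labeling[OF assms(1) D D]
      by (simp add: path_component_in_path_components_of path_component_of_refl)
    fix D' assume "D' \<in> dimer_coverings \<Gamma>"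
    then show "char_labeling \<Gamma> D' \<in> ?C"
      using path_component_char_labeling[OF assms(1) D] by simp
  next
    fix C assume C: "C \<in> path_components_of (labeling_space \<Gamma>) \<and>
      (\<forall>D\<in>dimer_coverings \<Gamma>. char_labeling \<Gamma> D \<in> C)"
    then have "char_labeling \<Gamma> D \<in> C"
      using D by blast
    with C show "C = ?C"
      unfolding path_components_of_def by (auto simp: path_component_of_equiv)
  qed
qed

end

theory Submission
  imports Defs
begin

text \<open>
  A point of the dimer complex records a dimer covering \<open>A\<close>, independent even cycles \<open>S\<close> along which \<open>A\<close> alternates, and
  a coordinate \<open>x s\<close> in the unit interval for each cycle.  It yields a dimer labeling: on \<open>s\<close> the edges of \<open>A\<close> get the label
  \<open>1 - x s\<close> and the other edges \<open>x s\<close>, and off the cycles the labeling is the indicator of \<open>A\<close>.  This respects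
  the gluing (\<open>cube_labeling_glue\<close>), so it defines a continuous map on the complex.  The map is
  injective (\<open>cube_labeling_inj\<close>): the edges with labels strictly between \<open>0\<close> and \<open>1\<close> form the union of the cycles
  with coordinates different from \<open>0\<close> and \<open>1\<close>, and an alternating set on a cycle is unique up to complement.

  Conversely, in any dimer labeling the edges with labels strictly between \<open>0\<close> and \<open>1\<close> form disjoint
  cycles, with labels \<open>a\<close>, \<open>1 - a\<close>, \<open>a\<close>, \<dots> along each of them.  If all these cycles are even, the labeling comes
  from a point of the dimer complex (\<open>cube_labeling_surj\<close>).  On an odd cycle all labels must be \<open>1/2\<close>.
  That a given odd cycle is labelled by \<open>1/2\<close> is a condition both open and closed (\<open>odd_labelings_clopen\<close>), so
  the set of such odd cycles is constant on path components.  It is empty at characteristic labelings of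
  dimer coverings, and every point of the complex is joined to one of these by shrinking the coordinates.
  Thus the image of the complex is the component of the dimer coverings, and by compactness the bijection
  is a homeomorphism.

  A labeling with odd cycles is rigid near them: \<open>1/2\<close> on the cycles, \<open>0\<close> on the other edges meeting
  them.  Deleting these cycles with all incident edges therefore identifies the labelings having exactly these odd
  cycles with the labelings of a subgraph that have no odd cycle at all
  (\<open>odd_cycle_component_homeomorphic\<close>).  The latter form the component treated before, for the subgraph;
  in particular they are path-connected, so the former are a whole path component.
\<close>

section \<open>Circles, two-colourings and edge components\<close>

text \<open>Connectedness of a circle, in the form that spreads a relation between adjacent edges to the whole
  circle.\<close>

lemma circle_induct:
  assumes "forms_circle \<Gamma> s" "e \<in> s" "P e"
    and step: "\<And>e f. \<lbrakk>e \<in> s; f \<in> s; P e; ends \<Gamma> e \<inter> ends \<Gamma> f \<noteq> {}\<rbrakk> \<Longrightarrow> P f"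
    and f: "f \<in> s"
  shows "P f"
proof -
  obtain n vs es where n: "n \<ge> 2" "length vs = n" "length es = n" "set es = s"
    and ends: "\<And>i. i < n \<Longrightarrow> ends \<Gamma> (es ! i) = {vs ! i, vs ! (Suc i mod n)}"
    using assms(1) unfolding forms_circle_def by blast
  obtain i where i: "i < n" "es ! i = e" using n assms(2) by (metis in_set_conv_nth)
  obtain j where j: "j < n" "es ! j = f" using n f by (metis in_set_conv_nth)
  have "P (es ! ((i + k) mod n))" for k
  proof (induction k)
    case 0
    then show ?case using i assms(3) by simp
  next
    case (Suc k)
    let ?a = "(i + k) mod n" and ?b = "(i + Suc k) mod n"
    have ab: "?a < n" "?b < n" "?b = Suc ?a mod n" using n(1) by (auto simp: mod_Suc_eq)
    then have "vs ! ?b \<in> ends \<Gamma> (es ! ?a) \<inter> ends \<Gamma> (es ! ?b)"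
      using ends[of ?a] ends[of ?b] by simp
    moreover have "es ! ?a \<in> s" "es ! ?b \<in> s" using n ab by (metis nth_mem)+
    ultimately show ?case using step[of "es ! ?a" "es ! ?b"] Suc.IH by blast
  qed
  \<comment> \<open>from index \<open>i\<close> back to \<open>0\<close>, then on to \<open>j\<close>; indices count modulo \<open>n\<close>\<close>
  from this[of "n - i + j"] show ?thesis using i j by simp
qed

text \<open>A two-colouring of the edges of \<open>s\<close>, with colour classes \<open>s \<inter> A\<close> and \<open>s - A\<close>.  On a cycle it is one of the two
  perfect matchings, seen only through adjacency of edges; \<open>A\<close> may contain edges outside \<open>s\<close>.\<close>

definition alternating :: "('v, 'e) mgraph \<Rightarrow> 'e set \<Rightarrow> 'e set \<Rightarrow> bool" where
  "alternating \<Gamma> s A \<longleftrightarrow>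
     (\<forall>e\<in>s. \<forall>f\<in>s. e \<noteq> f \<and> ends \<Gamma> e \<inter> ends \<Gamma> f \<noteq> {} \<longrightarrow> (e \<in> A \<longleftrightarrow> f \<notin> A))"

text \<open>Colour the sides of the polygon by the parity of their index; an even number of sides makes the parity
  change also between the last side and the first.\<close>

lemma even_cycle_alternating:
  assumes "even_cycle \<Gamma> s"
  obtains A where "A \<subseteq> s" "alternating \<Gamma> s A"
proof -
  obtain n vs es where n: "n \<ge> 2" "length vs = n" "length es = n" "set es = s"
    and d: "distinct vs" "distinct es"
    and ends: "\<And>i. i < n \<Longrightarrow> ends \<Gamma> (es ! i) = {vs ! i, vs ! (Suc i mod n)}"
    using assms unfolding even_cycle_def cycle_def forms_circle_def by blast
  have "card s = n" using n d distinct_card by metis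
  then have ev: "even n" using assms by (simp add: even_cycle_def)
  have par: "even (Suc i mod n) \<longleftrightarrow> odd i" if "i < n" for i
    using ev that by (auto simp: mod_Suc)
  define A where "A = {es ! i | i. i < n \<and> even i}"
  have A: "es ! i \<in> A \<longleftrightarrow> even i" if "i < n" for i
    using that d n by (auto simp: A_def nth_eq_iff_index_eq)
  have "A \<subseteq> s" using n by (auto simp: A_def)
  moreover have "alternating \<Gamma> s A"
    unfolding alternating_def
  proof (intro ballI impI)
    fix e f assume ef: "e \<in> s" "f \<in> s" "e \<noteq> f \<and> ends \<Gamma> e \<inter> ends \<Gamma> f \<noteq> {}"
    obtain i where i: "i < n" "es ! i = e" using n ef by (metis in_set_conv_nth)
    obtain j where j: "j < n" "es ! j = f" using n ef by (metis in_set_conv_nth)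
    have ij: "i \<noteq> j" using ef i j by blast
    have vne: "vs ! p = vs ! q \<longleftrightarrow> p = q" if "p < n" "q < n" for p q
      using that n d by (simp add: nth_eq_iff_index_eq)
    have si: "Suc i mod n < n" "Suc j mod n < n" using n by auto
    have sij: "Suc i mod n = Suc j mod n \<longleftrightarrow> i = j"
      using i j by (auto simp: mod_Suc)
    have "{vs ! i, vs ! (Suc i mod n)} \<inter> {vs ! j, vs ! (Suc j mod n)} \<noteq> {}"
      using ef i j ends by metis
    then have "i = Suc j mod n \<or> j = Suc i mod n"
      using vne i j si sij ij by auto
    then have "even i \<longleftrightarrow> odd j" using par i j by blast
    then show "(e \<in> A) = (f \<notin> A)" using A i j by blast
  qed
  ultimately show ?thesis using that by blast
qed

text \<open>Membership in \<open>A\<close> flips at each corner, and must be back at its initial value after one turn.\<close>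

lemma alternating_imp_even:
  assumes "forms_circle \<Gamma> s" "alternating \<Gamma> s A"
  shows "even (card s)"
proof -
  obtain n vs es where n: "n \<ge> 2" "length vs = n" "length es = n" "set es = s"
    and d: "distinct vs" "distinct es"
    and ends: "\<And>i. i < n \<Longrightarrow> ends \<Gamma> (es ! i) = {vs ! i, vs ! (Suc i mod n)}"
    using assms unfolding forms_circle_def by blast
  have cs: "card s = n" using n d distinct_card by metis
  have alt: "es ! i \<in> A \<longleftrightarrow> es ! (Suc i mod n) \<notin> A" if "i < n" for i
  proof -
    let ?b = "Suc i mod n"
    have b: "?b < n" "?b \<noteq> i" using n that by (auto simp: mod_Suc)
    have "vs ! ?b \<in> ends \<Gamma> (es ! i) \<inter> ends \<Gamma> (es ! ?b)"
      using ends[of i] ends[of ?b] that b by simp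
    moreover have "es ! i \<in> s" "es ! ?b \<in> s" using n b that by (metis nth_mem)+
    moreover have "es ! i \<noteq> es ! ?b" using d n b that by (simp add: nth_eq_iff_index_eq)
    ultimately show ?thesis using assms(2) unfolding alternating_def by blast
  qed
  have par: "es ! i \<in> A \<longleftrightarrow> (even i \<longleftrightarrow> es ! 0 \<in> A)" if "i < n" for i
    using that
  proof (induction i)
    case (Suc i)
    then show ?case using alt[of i] by auto
  qed simp
  have "es ! (n - 1) \<in> A \<longleftrightarrow> es ! 0 \<notin> A" using alt[of "n - 1"] n by simp
  with par[of "n - 1"] n have "odd (n - 1)" by auto
  then show ?thesis using cs n by auto
qed

text \<open>Walk along \<open>s\<close>, leaving each vertex by the edge of \<open>s\<close> other than the one of arrival.  By finiteness some
  vertex is visited twice.  The first revisited vertex is the starting point: at any later one, a third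
  edge of \<open>s\<close> would arrive.  The closed walk obtained in this way is a polygon, and it uses both edges
  of \<open>s\<close> at each of its vertices, so by connectedness it exhausts \<open>s\<close>.\<close>

lemma connected_cyclic_set_forms_circle:
  assumes fin: "finite_mgraph \<Gamma>" and cyc: "cyclic_set \<Gamma> s" and ne: "e \<in> s"
    and conn: "\<And>P. \<lbrakk>P \<subseteq> s; P \<noteq> {}; \<And>e f. \<lbrakk>e \<in> P; f \<in> s; ends \<Gamma> e \<inter> ends \<Gamma> f \<noteq> {}\<rbrakk> \<Longrightarrow> f \<in> P\<rbrakk> \<Longrightarrow> P = s"
  shows "forms_circle \<Gamma> s"
proof -
  have ends2: "ends \<Gamma> f \<subseteq> verts \<Gamma>" "card (ends \<Gamma> f) = 2" if "f \<in> s" for f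
    using that fin cyc by (auto simp: finite_mgraph_def mgraph_def cyclic_set_def)
  have two: "card (incident \<Gamma> v s) = 2" if "f \<in> s" "v \<in> ends \<Gamma> f" for f v
  proof -
    have "v \<in> verts \<Gamma>" using ends2(1)[OF that(1)] that(2) by blast
    moreover have "f \<in> incident \<Gamma> v s" using that by (simp add: incident_def)
    ultimately show ?thesis using cyc unfolding cyclic_set_def by blast
  qed
  define D where "D = {(v, f). f \<in> s \<and> v \<in> ends \<Gamma> f}"
  \<comment> \<open>one step of the walk: leave through the other end, along the other edge there\<close>
  have step: "\<exists>w g. (w, g) \<in> D \<and> ends \<Gamma> f = {v, w} \<and> w \<noteq> v \<and> w \<in> ends \<Gamma> g \<and> g \<noteq> f"
    if vf: "(v, f) \<in> D" for v f
  proof -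
    have f: "f \<in> s" "v \<in> ends \<Gamma> f" using vf by (auto simp: D_def)
    obtain x y where "ends \<Gamma> f = {x, y}" "x \<noteq> y"
      using ends2(2)[OF f(1)] by (meson card_2_iff)
    with f(2) obtain w where w: "ends \<Gamma> f = {v, w}" "w \<noteq> v"
      by (metis insertE insert_commute singletonD)
    have "card (incident \<Gamma> w s) = 2" using two[OF f(1)] w by blast
    then obtain x y where "incident \<Gamma> w s = {x, y}" "x \<noteq> y" by (meson card_2_iff)
    then obtain g where "g \<in> incident \<Gamma> w s" "g \<noteq> f" by blast
    then show ?thesis using w by (auto simp: incident_def D_def)
  qed
  obtain v0 where v0: "v0 \<in> ends \<Gamma> e" using ends2(2)[OF ne] by fastforce
  define nxt where "nxt = (\<lambda>p. SOME q. q \<in> D \<and> ends \<Gamma> (snd p) = {fst p, fst q} \<and>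
     fst q \<noteq> fst p \<and> fst q \<in> ends \<Gamma> (snd q) \<and> snd q \<noteq> snd p)"
  have nxt: "nxt p \<in> D \<and> ends \<Gamma> (snd p) = {fst p, fst (nxt p)} \<and>
     fst (nxt p) \<noteq> fst p \<and> fst (nxt p) \<in> ends \<Gamma> (snd (nxt p)) \<and> snd (nxt p) \<noteq> snd p" if "p \<in> D" for p
    unfolding nxt_def by (rule someI_ex) (use step[of "fst p" "snd p"] that in auto)
  define w where "w = (\<lambda>i. (nxt ^^ i) (v0, e))"
  have wD: "w i \<in> D" for i
    by (induction i) (use nxt ne v0 in \<open>auto simp: w_def D_def\<close>)
  define v where "v = (\<lambda>i. fst (w i))"
  define es where "es = (\<lambda>i. snd (w i))"
  have es_s: "es i \<in> s" for i using wD[of i] by (auto simp: D_def es_def)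
  have wS: "w (Suc i) = nxt (w i)" for i by (simp add: w_def)
  have E: "ends \<Gamma> (es i) = {v i, v (Suc i)}" "v (Suc i) \<noteq> v i" "es (Suc i) \<noteq> es i" for i
    using nxt[OF wD[of i]] by (auto simp: v_def es_def wS)
  have vV: "v i \<in> verts \<Gamma>" for i using E(1)[of i] ends2(1)[OF es_s[of i]] by auto
  have "\<not> inj v"
    using vV fin finite_imageD[of v UNIV] by (auto simp: finite_mgraph_def intro: finite_subset)
  then obtain a b where "a < b" "v a = v b" by (metis injI linorder_neqE_nat)
  then have ex: "\<exists>n. \<exists>j<n. v j = v n" by blast
  \<comment> \<open>the first time at which the walk revisits a vertex\<close>
  define n where "n = (LEAST n. \<exists>j<n. v j = v n)"
  obtain j where j: "j < n" "v j = v n" using LeastI_ex[OF ex] unfolding n_def by blast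
  have inj: "v p = v q \<longleftrightarrow> p = q" if "p < n" "q < n" for p q
  proof -
    have "\<not> (\<exists>j<m. v j = v m)" if "m < n" for m using not_less_Least[of m] that unfolding n_def by blast
    then show ?thesis using that by (metis linorder_neqE_nat)
  qed
  have at_v: "incident \<Gamma> (v (Suc i)) s = {es i, es (Suc i)}" for i
  proof -
    have "{es i, es (Suc i)} \<subseteq> incident \<Gamma> (v (Suc i)) s"
      using E(1)[of i] E(1)[of "Suc i"] es_s by (auto simp: incident_def)
    moreover have "card (incident \<Gamma> (v (Suc i)) s) = 2"
      using two[OF es_s[of i]] E(1)[of i] by blast
    ultimately show ?thesis
      using E(3)[of i] by (metis card_2_iff card_subset_eq card.infinite zero_neq_numeral)
  qed
  have n1: "n \<ge> 2"
  proof (rule ccontr)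
    assume "\<not> ?thesis" then have "n = 1" using j by linarith
    then show False using j E(2)[of 0] by simp
  qed
  \<comment> \<open>Both edges of \<open>s\<close> at \<open>v j\<close> were used in the first visit; the arriving edge can be neither of them.\<close>
  have j0: "j = 0"
  proof (rule ccontr)
    assume "j \<noteq> 0"
    then obtain i where i: "j = Suc i" by (cases j) auto
    obtain m where m: "n = Suc m" using n1 by (cases n) auto
    have "es m \<in> incident \<Gamma> (v n) s" using at_v[of m] m by simp
    then have "es m \<in> {es i, es j}" using j at_v[of i] i by simp
    then show False
    proof (elim insertE emptyE)
      assume "es m = es i"
      then have "{v m, v n} = {v i, v j}" using E(1) m i by metis
      then have "v m = v i" using j(2) by (metis doubleton_eq_iff)
      then show False using inj[of m i] i j m by simp
    next
      assume eq: "es m = es j"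
      then have "{v m, v n} = {v j, v (Suc j)}" using E(1) m by metis
      then have vm: "v m = v (Suc j)" using j(2) by (metis doubleton_eq_iff)
      show False
      proof (cases "Suc j = n")
        case True then show False using j(2) E(2)[of j] by simp
      next
        case False
        then have "m = Suc j" using inj[of m "Suc j"] vm m j by simp
        then show False using eq E(3)[of j] by simp
      qed
    qed
  qed
  have vn: "v n = v 0" using j j0 by simp
  have vmod: "v (Suc i mod n) = v (Suc i)" if "i < n" for i
    using that vn by (auto simp: mod_Suc)
  have einj: "i = k" if eq: "es i = es k" and ik: "i \<le> k" "k < n" for i k
  proof (rule ccontr)
    assume ne': "i \<noteq> k"
    have "{v i, v (Suc i)} = {v k, v (Suc k)}" using E(1) eq by metis
    moreover have "v i \<noteq> v k" using inj[of i k] ik ne' by simp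
    ultimately have "v k = v (Suc i)" "v i = v (Suc k)" by (auto simp: doubleton_eq_iff)
    then have "k = Suc i" using inj[of k "Suc i"] ik ne' by simp
    then show False using E(3)[of i] eq by simp
  qed
  have last: "incident \<Gamma> (v 0) s = {es (n - 1), es 0}"
  proof -
    have ne0: "es (n - 1) \<noteq> es 0" using einj[of 0 "n - 1"] n1 by fastforce
    have "es (n - 1) \<in> incident \<Gamma> (v n) s" using at_v[of "n - 1"] n1 by simp
    then have "{es (n - 1), es 0} \<subseteq> incident \<Gamma> (v 0) s"
      using E(1)[of 0] es_s vn by (auto simp: incident_def)
    moreover have "card (incident \<Gamma> (v 0) s) = 2"
      using two[OF es_s[of 0]] E(1)[of 0] by blast
    ultimately show ?thesis
      using ne0 by (metis card_2_iff card_subset_eq card.infinite zero_neq_numeral)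
  qed
  have "es ` {..<n} = s"
  proof (rule conn)
    show "es ` {..<n} \<subseteq> s" using es_s by blast
    show "es ` {..<n} \<noteq> {}" using n1 by (simp add: lessThan_empty_iff)
  next
    fix g f assume g: "g \<in> es ` {..<n}" and f: "f \<in> s" "ends \<Gamma> g \<inter> ends \<Gamma> f \<noteq> {}"
    obtain i where i: "i < n" "g = es i" using g by blast
    have "v i \<in> ends \<Gamma> f \<or> v (Suc i mod n) \<in> ends \<Gamma> f" using f(2) i E(1)[of i] vmod[of i] by auto
    then obtain k where k: "k < n" "v k \<in> ends \<Gamma> f" using i n1 by (metis mod_less_divisor gr_implies_not0 neq0_conv)
    then have "f \<in> incident \<Gamma> (v k) s" using f by (simp add: incident_def)
    then show "f \<in> es ` {..<n}"
      using last at_v[of "k - 1"] k n1 by (cases k) auto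
  qed
  then show ?thesis
    unfolding forms_circle_def
  proof (intro exI[of _ n] exI[of _ "map v [0..<n]"] exI[of _ "map es [0..<n]"] conjI allI impI)
    show "distinct (map v [0..<n])" using inj by (auto simp: distinct_map inj_on_def)
    show "distinct (map es [0..<n])"
      using einj by (auto simp: distinct_map inj_on_def) (metis nat_le_linear)
    fix i assume "i < n"
    then show "ends \<Gamma> (map es [0..<n] ! i) =
        {map v [0..<n] ! i, map v [0..<n] ! (Suc i mod n)}"
      using E(1)[of i] vmod[of i] n1 by simp
  qed (use n1 \<open>es ` {..<n} = s\<close> in \<open>auto simp: atLeast0LessThan\<close>)
qed

definition edge_component :: "('v, 'e) mgraph \<Rightarrow> 'e set \<Rightarrow> 'e \<Rightarrow> 'e set" where
  "edge_component \<Gamma> H e =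
     {f. (e, f) \<in> {(e, f). e \<in> H \<and> f \<in> H \<and> ends \<Gamma> e \<inter> ends \<Gamma> f \<noteq> {}}\<^sup>*}"

lemma edge_component_self: "e \<in> edge_component \<Gamma> H e"
  by (simp add: edge_component_def)

lemma edge_component_subset:
  assumes "e \<in> H" shows "edge_component \<Gamma> H e \<subseteq> H"
proof
  fix f assume "f \<in> edge_component \<Gamma> H e"
  then show "f \<in> H"
    unfolding edge_component_def mem_Collect_eq
    by (induction rule: rtrancl_induct) (use assms in auto)
qed

lemma edge_component_closed:
  assumes "e \<in> H" "f \<in> edge_component \<Gamma> H e" "g \<in> H" "ends \<Gamma> f \<inter> ends \<Gamma> g \<noteq> {}"
  shows "g \<in> edge_component \<Gamma> H e"
proof -
  have "f \<in> H" using edge_component_subset[OF assms(1)] assms(2) by blast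
  let ?R = "{(e, f). e \<in> H \<and> f \<in> H \<and> ends \<Gamma> e \<inter> ends \<Gamma> f \<noteq> {}}"
  have "(e, f) \<in> ?R\<^sup>*" using assms(2) by (simp add: edge_component_def)
  moreover have "(f, g) \<in> ?R" using \<open>f \<in> H\<close> assms by simp
  ultimately have "(e, g) \<in> ?R\<^sup>*" by (rule rtrancl_into_rtrancl)
  then show ?thesis by (simp add: edge_component_def)
qed

lemma edge_component_connected:
  assumes "P \<subseteq> edge_component \<Gamma> H e" "P \<noteq> {}" "e \<in> H"
    and cl: "\<And>e' f. \<lbrakk>e' \<in> P; f \<in> edge_component \<Gamma> H e; ends \<Gamma> e' \<inter> ends \<Gamma> f \<noteq> {}\<rbrakk> \<Longrightarrow> f \<in> P"
  shows "P = edge_component \<Gamma> H e"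
proof -
  let ?R = "{(e, f). e \<in> H \<and> f \<in> H \<and> ends \<Gamma> e \<inter> ends \<Gamma> f \<noteq> {}}"
  have "sym ?R" by (auto simp: sym_def)
  then have symR: "sym (?R\<^sup>*)" by (rule sym_rtrancl)
  obtain p where p: "p \<in> P" using assms by blast
  have reach: "h \<in> P" if "(p, h) \<in> ?R\<^sup>*" for h
    using that
  proof (induction rule: rtrancl_induct)
    case (step y z)
    then have "z \<in> edge_component \<Gamma> H e"
      using edge_component_closed[of e H y \<Gamma> z] assms(1,3) by blast
    then show ?case using cl[of y z] step by blast
  qed (rule p)
  have "h \<in> P" if "h \<in> edge_component \<Gamma> H e" for h
  proof -
    have "(e, p) \<in> ?R\<^sup>*" using p assms(1) by (auto simp: edge_component_def)
    then have "(p, e) \<in> ?R\<^sup>*" using symR by (meson symD)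
    moreover have "(e, h) \<in> ?R\<^sup>*" using that by (simp add: edge_component_def)
    ultimately show ?thesis using reach by (meson rtrancl_trans)
  qed
  then show ?thesis using assms(1) by blast
qed

lemma edge_component_eq:
  assumes "e \<in> H" "e' \<in> H" "f \<in> edge_component \<Gamma> H e" "f' \<in> edge_component \<Gamma> H e'"
    "ends \<Gamma> f \<inter> ends \<Gamma> f' \<noteq> {}"
  shows "edge_component \<Gamma> H e = edge_component \<Gamma> H e'"
proof -
  let ?P = "edge_component \<Gamma> H e \<inter> edge_component \<Gamma> H e'"
  have "f' \<in> H" using edge_component_subset[OF assms(2)] assms(4) by blast
  then have "f' \<in> ?P" using edge_component_closed[OF assms(1,3) _ assms(5)] assms(4) by blast
  then have ne: "?P \<noteq> {}" by blast
  have cl: "h \<in> ?P" if "g \<in> ?P" "h \<in> H" "ends \<Gamma> g \<inter> ends \<Gamma> h \<noteq> {}" for g h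
    using edge_component_closed[OF assms(1) _ that(2,3)] edge_component_closed[OF assms(2) _ that(2,3)]
      that(1) by blast
  have "?P = edge_component \<Gamma> H e"
    by (rule edge_component_connected[OF _ ne assms(1)])
      (use cl edge_component_subset[OF assms(1)] in blast)+
  moreover have "?P = edge_component \<Gamma> H e'"
    by (rule edge_component_connected[OF _ ne assms(2)])
      (use cl edge_component_subset[OF assms(2)] in blast)+
  ultimately show ?thesis by simp
qed

text \<open>A component contains, with one edge at a vertex, all edges of \<open>H\<close> there; so it is again cyclic, and it is
  connected.\<close>

lemma edge_component_cycle:
  assumes fin: "finite_mgraph \<Gamma>" and cyc: "cyclic_set \<Gamma> H" and e: "e \<in> H"
  shows "cycle \<Gamma> (edge_component \<Gamma> H e)"
proof -
  let ?K = "edge_component \<Gamma> H e"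
  have KH: "?K \<subseteq> H" using edge_component_subset[OF e] .
  have inc: "incident \<Gamma> v ?K = incident \<Gamma> v H" if "incident \<Gamma> v ?K \<noteq> {}" for v
    using that KH edge_component_closed[OF e] unfolding incident_def by blast
  have "cyclic_set \<Gamma> ?K"
    unfolding cyclic_set_def
  proof (intro conjI ballI)
    show "?K \<subseteq> edges \<Gamma>" "finite ?K"
      using KH cyc by (auto simp: cyclic_set_def intro: finite_subset)
    fix v assume "v \<in> verts \<Gamma>"
    then show "card (incident \<Gamma> v ?K) = 2 \<or> incident \<Gamma> v ?K = {}"
      using inc[of v] cyc unfolding cyclic_set_def by metis
  qed
  moreover from this have "forms_circle \<Gamma> ?K"
    by (rule connected_cyclic_set_forms_circle[OF fin _ edge_component_self])
      (use edge_component_connected[OF _ _ e] in blast)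
  ultimately show ?thesis by (simp add: cycle_def)
qed

section \<open>Labels at a vertex and odd cycles\<close>

text \<open>The condition that a dimer labeling satisfies at one vertex, with the edges of nonzero label
  named instead of counted.\<close>

definition splits_one :: "('e \<Rightarrow> real) \<Rightarrow> 'e set \<Rightarrow> bool" where
  "splits_one l I \<longleftrightarrow>
     (\<exists>a\<in>I. l a = 1 \<and> (\<forall>g\<in>I - {a}. l g = 0)) \<or>
     (\<exists>a\<in>I. \<exists>b\<in>I. a \<noteq> b \<and> 0 < l a \<and> 0 < l b \<and> l a + l b = 1 \<and> (\<forall>g\<in>I - {a, b}. l g = 0))"

lemma splits_one_singleI:
  "\<lbrakk>a \<in> I; l a = 1; \<And>g. \<lbrakk>g \<in> I; g \<noteq> a\<rbrakk> \<Longrightarrow> l g = 0\<rbrakk> \<Longrightarrow> splits_one l I"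
  unfolding splits_one_def by blast

lemma splits_one_pairI:
  "\<lbrakk>a \<in> I; b \<in> I; a \<noteq> b; 0 < l a; 0 < l b; l a + l b = 1;
    \<And>g. \<lbrakk>g \<in> I; g \<noteq> a; g \<noteq> b\<rbrakk> \<Longrightarrow> l g = 0\<rbrakk> \<Longrightarrow> splits_one l I"
  unfolding splits_one_def by (intro disjI2 bexI[of _ a] bexI[of _ b]) auto

lemma splits_one_iff:
  assumes "finite I" "\<forall>g\<in>I. 0 \<le> l g"
  shows "(\<Sum>e\<in>I. l e) = 1 \<and> card {e \<in> I. l e \<noteq> 0} \<in> {1, 2} \<longleftrightarrow> splits_one l I"
proof
  assume *: "(\<Sum>e\<in>I. l e) = 1 \<and> card {e \<in> I. l e \<noteq> 0} \<in> {1, 2}"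
  let ?N = "{e \<in> I. l e \<noteq> 0}"
  have "(\<Sum>e\<in>?N. l e) = (\<Sum>e\<in>I. l e)"
    by (rule sum.mono_neutral_left) (use assms(1) in auto)
  then have sumN: "(\<Sum>e\<in>?N. l e) = 1" using * by simp
  from * consider "card ?N = 1" | "card ?N = 2" by blast
  then show "splits_one l I"
  proof cases
    case 1
    then obtain a where a: "?N = {a}" by (meson card_1_singletonE)
    then have "g \<in> I \<and> l g \<noteq> 0 \<longleftrightarrow> g = a" for g by (simp add: set_eq_iff)
    then have "a \<in> I" "\<forall>g\<in>I - {a}. l g = 0" by blast+
    moreover have "l a = 1" using sumN a by simp
    ultimately show ?thesis unfolding splits_one_def by blast
  next
    case 2
    then obtain a b where ab: "?N = {a, b}" "a \<noteq> b" by (meson card_2_iff)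
    then have "g \<in> I \<and> l g \<noteq> 0 \<longleftrightarrow> g = a \<or> g = b" for g by (simp add: set_eq_iff)
    then have "a \<in> I" "b \<in> I" "l a \<noteq> 0" "l b \<noteq> 0" and "\<forall>g\<in>I - {a, b}. l g = 0" by blast+
    moreover from this have "0 < l a" "0 < l b" using assms(2) by force+
    moreover have "l a + l b = 1" using sumN ab by simp
    ultimately show ?thesis using ab(2) unfolding splits_one_def by blast
  qed
next
  assume "splits_one l I"
  then show "(\<Sum>e\<in>I. l e) = 1 \<and> card {e \<in> I. l e \<noteq> 0} \<in> {1, 2}"
    unfolding splits_one_def
  proof (elim disjE bexE conjE)
    fix a assume a: "a \<in> I" "l a = 1" "\<forall>g\<in>I - {a}. l g = 0"
    then have "{e \<in> I. l e \<noteq> 0} = {a}" by auto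
    moreover have "(\<Sum>e\<in>I. l e) = (\<Sum>e\<in>{a}. l e)"
      by (rule sum.mono_neutral_right) (use a assms in auto)
    ultimately show ?thesis using a by simp
  next
    fix a b assume ab: "a \<in> I" "b \<in> I" "a \<noteq> b" "0 < l a" "0 < l b" "l a + l b = 1"
      "\<forall>g\<in>I - {a, b}. l g = 0"
    then have "{e \<in> I. l e \<noteq> 0} = {a, b}" by auto
    moreover have "(\<Sum>e\<in>I. l e) = (\<Sum>e\<in>{a, b}. l e)"
      by (rule sum.mono_neutral_right) (use ab assms in auto)
    ultimately show ?thesis using ab by simp
  qed
qed

lemma splits_one_range:
  assumes "splits_one l I" "g \<in> I"
  shows "0 \<le> l g \<and> l g \<le> 1"
  using assms(1) unfolding splits_one_def
proof (elim disjE bexE conjE)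
  fix a assume "a \<in> I" "l a = 1" "\<forall>g\<in>I - {a}. l g = 0"
  then show ?thesis using assms(2) by (cases "g = a") auto
next
  fix a b assume "0 < l a" "0 < l b" "l a + l b = 1" "\<forall>g\<in>I - {a, b}. l g = 0"
  then show ?thesis using assms(2) by (cases "g = a \<or> g = b") auto
qed

lemma splits_one_pair:
  "\<lbrakk>splits_one l I; a \<in> I; b \<in> I; a \<noteq> b; 0 < l a; 0 < l b\<rbrakk>
    \<Longrightarrow> l a + l b = 1 \<and> (\<forall>g\<in>I - {a, b}. l g = 0)"
  unfolding splits_one_def
  by (elim disjE bexE conjE) (metis Diff_iff insert_iff less_irrefl singletonD add.commute)+

lemma splits_one_partner:
  assumes "splits_one l I" "a \<in> I" "0 < l a" "l a < 1"
  obtains b where "b \<in> I" "b \<noteq> a" "0 < l b" "l b < 1" "l a + l b = 1" "\<forall>g\<in>I - {a, b}. l g = 0"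
proof -
  from assms(1) show ?thesis
    unfolding splits_one_def
  proof (elim disjE bexE conjE)
    fix c assume "c \<in> I" "l c = 1" "\<forall>g\<in>I - {c}. l g = 0"
    then show ?thesis using assms(2-4) by (cases "a = c") auto
  next
    fix c d assume c: "c \<in> I" "d \<in> I" "c \<noteq> d" "0 < l c" "0 < l d" "l c + l d = 1"
      "\<forall>g\<in>I - {c, d}. l g = 0"
    then have "a = c \<or> a = d" using assms(2,3) by force
    then show ?thesis
    proof
      assume "a = c" then show ?thesis using that[of d] c by auto
    next
      assume "a = d"
      moreover have "I - {d, c} = I - {c, d}" by blast
      ultimately show ?thesis using that[of c] c by auto
    qed
  qed
qed

lemma finite_mgraphD:
  assumes "finite_mgraph \<Gamma>"
  shows "finite (edges \<Gamma>)" "finite (verts \<Gamma>)" "\<And>e. e \<in> edges \<Gamma> \<Longrightarrow> ends \<Gamma> e \<subseteq> verts \<Gamma>"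
    "\<And>e. e \<in> edges \<Gamma> \<Longrightarrow> ends \<Gamma> e \<noteq> {}" "\<And>v s. s \<subseteq> edges \<Gamma> \<Longrightarrow> finite (incident \<Gamma> v s)"
  using assms by (auto simp: finite_mgraph_def mgraph_def incident_def intro: finite_subset)

lemma dimer_labelings_iff:
  assumes fin: "finite_mgraph \<Gamma>"
  shows "l \<in> dimer_labelings \<Gamma> \<longleftrightarrow>
    l \<in> extensional (edges \<Gamma>) \<and> (\<forall>v\<in>verts \<Gamma>. splits_one l (incident \<Gamma> v (edges \<Gamma>)))"
    (is "_ \<longleftrightarrow> ?R")
proof
  have finI: "finite (incident \<Gamma> v (edges \<Gamma>))" for v using finite_mgraphD[OF fin] by blast
  {
    assume l: "l \<in> dimer_labelings \<Gamma>"
    then have "\<forall>g\<in>incident \<Gamma> v (edges \<Gamma>). 0 \<le> l g" for v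
      by (auto simp: dimer_labelings_def incident_def)
    with l show ?R
      using splits_one_iff[OF finI] by (auto simp: dimer_labelings_def PiE_iff)
  }
  assume r: ?R
  have nn: "0 \<le> l e" if e: "e \<in> edges \<Gamma>" for e
  proof -
    obtain v where "v \<in> ends \<Gamma> e" "v \<in> verts \<Gamma>" using finite_mgraphD(3,4)[OF fin e] by blast
    then show ?thesis using r e splits_one_range[of l _ e] by (auto simp: incident_def)
  qed
  then have "\<forall>g\<in>incident \<Gamma> v (edges \<Gamma>). 0 \<le> l g" for v by (auto simp: incident_def)
  then show "l \<in> dimer_labelings \<Gamma>"
    using r nn splits_one_iff[OF finI] by (auto simp: dimer_labelings_def PiE_iff)
qed

definition fractional_edges :: "('v, 'e) mgraph \<Rightarrow> ('e \<Rightarrow> real) \<Rightarrow> 'e set" where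
  "fractional_edges \<Gamma> l = {e \<in> edges \<Gamma>. 0 < l e \<and> l e < 1}"

definition odd_cycle :: "('v, 'e) mgraph \<Rightarrow> 'e set \<Rightarrow> bool" where
  "odd_cycle \<Gamma> c \<longleftrightarrow> cycle \<Gamma> c \<and> odd (card c)"

text \<open>This set of cycles is the invariant that separates the components of the space of dimer labelings.\<close>

definition odd_cycles_of :: "('v, 'e) mgraph \<Rightarrow> ('e \<Rightarrow> real) \<Rightarrow> 'e set set" where
  "odd_cycles_of \<Gamma> l = {c. odd_cycle \<Gamma> c \<and> (\<forall>e\<in>c. l e = 1/2)}"

lemma cycle_subset: "cycle \<Gamma> c \<Longrightarrow> c \<subseteq> edges \<Gamma>"
  by (simp add: cycle_def cyclic_set_def)

lemma cycle_nonempty: assumes "cycle \<Gamma> c" shows "c \<noteq> {}"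
  using assms unfolding cycle_def forms_circle_def by (metis length_0_conv not_numeral_le_zero set_empty)

context
  fixes \<Gamma> :: "('v, 'e) mgraph"
  assumes fin: "finite_mgraph \<Gamma>"
begin

lemma dimer_labeling_splits:
  assumes "l \<in> dimer_labelings \<Gamma>" "e \<in> edges \<Gamma>" "v \<in> ends \<Gamma> e"
  shows "splits_one l (incident \<Gamma> v (edges \<Gamma>))" "e \<in> incident \<Gamma> v (edges \<Gamma>)" "v \<in> verts \<Gamma>"
proof -
  show v: "v \<in> verts \<Gamma>" using finite_mgraphD(3)[OF fin assms(2)] assms(3) by blast
  then show "splits_one l (incident \<Gamma> v (edges \<Gamma>))"
    using assms(1) dimer_labelings_iff[OF fin] by blast
  show "e \<in> incident \<Gamma> v (edges \<Gamma>)" using assms by (simp add: incident_def)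
qed

lemma dimer_labeling_range:
  assumes "l \<in> dimer_labelings \<Gamma>" "e \<in> edges \<Gamma>"
  shows "0 \<le> l e" "l e \<le> 1"
proof -
  obtain v where "v \<in> ends \<Gamma> e" using finite_mgraphD(4)[OF fin assms(2)] by blast
  with splits_one_range dimer_labeling_splits[OF assms] show "0 \<le> l e" "l e \<le> 1" by metis+
qed

lemma topspace_labeling_space: "topspace (labeling_space \<Gamma>) = dimer_labelings \<Gamma>"
proof -
  have "dimer_labelings \<Gamma> \<subseteq> edges \<Gamma> \<rightarrow>\<^sub>E {0..1}"
  proof
    fix l assume l: "l \<in> dimer_labelings \<Gamma>"
    then have "l \<in> extensional (edges \<Gamma>)" using dimer_labelings_iff[OF fin] by blast
    then show "l \<in> edges \<Gamma> \<rightarrow>\<^sub>E {0..1}" using dimer_labeling_range[OF l] by (simp add: PiE_iff)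
  qed
  then show ?thesis by (auto simp: labeling_space_def)
qed

lemma dimer_labeling_pair:
  assumes "l \<in> dimer_labelings \<Gamma>" "e \<in> edges \<Gamma>" "f \<in> edges \<Gamma>" "e \<noteq> f"
    "0 < l e" "0 < l f" "ends \<Gamma> e \<inter> ends \<Gamma> f \<noteq> {}"
  shows "l e + l f = 1"
proof -
  obtain v where "v \<in> ends \<Gamma> e" "v \<in> ends \<Gamma> f" using assms by blast
  then show ?thesis
    using splits_one_pair[of l "incident \<Gamma> v (edges \<Gamma>)" e f] assms
      dimer_labeling_splits[of l _ v] by blast
qed

text \<open>A label strictly between \<open>0\<close> and \<open>1\<close> has exactly one partner at each end of its edge.\<close>

lemma fractional_edges_cyclic:
  assumes l: "l \<in> dimer_labelings \<Gamma>"
  shows "cyclic_set \<Gamma> (fractional_edges \<Gamma> l)"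
  unfolding cyclic_set_def
proof (intro conjI ballI)
  show "fractional_edges \<Gamma> l \<subseteq> edges \<Gamma>" "finite (fractional_edges \<Gamma> l)"
    using finite_mgraphD(1)[OF fin] by (auto simp: fractional_edges_def)
  fix v assume v: "v \<in> verts \<Gamma>"
  show "card (incident \<Gamma> v (fractional_edges \<Gamma> l)) = 2 \<or> incident \<Gamma> v (fractional_edges \<Gamma> l) = {}"
  proof (cases "incident \<Gamma> v (fractional_edges \<Gamma> l) = {}")
    case False
    then obtain a where a: "a \<in> incident \<Gamma> v (edges \<Gamma>)" "0 < l a" "l a < 1"
      by (auto simp: incident_def fractional_edges_def)
    have "splits_one l (incident \<Gamma> v (edges \<Gamma>))" using l v dimer_labelings_iff[OF fin] by blast
    then obtain b where b: "b \<in> incident \<Gamma> v (edges \<Gamma>)" "b \<noteq> a" "0 < l b" "l b < 1"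
      "\<forall>g\<in>incident \<Gamma> v (edges \<Gamma>) - {a, b}. l g = 0"
      by (rule splits_one_partner[where l = l]) (use a in auto)
    have "incident \<Gamma> v (fractional_edges \<Gamma> l) = {a, b}"
    proof (intro subset_antisym subsetI)
      fix g assume "g \<in> incident \<Gamma> v (fractional_edges \<Gamma> l)"
      then have "g \<in> incident \<Gamma> v (edges \<Gamma>)" "l g \<noteq> 0" by (auto simp: incident_def fractional_edges_def)
      then show "g \<in> {a, b}" using b(5) by blast
    qed (use a b in \<open>auto simp: incident_def fractional_edges_def\<close>)
    then show ?thesis using b(2) by simp
  qed simp
qed

lemma cycle_incident:
  assumes "cycle \<Gamma> c" "e \<in> c" "v \<in> ends \<Gamma> e"
  obtains f where "f \<in> c" "f \<noteq> e" "v \<in> ends \<Gamma> f" "incident \<Gamma> v c = {e, f}"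
proof -
  have e: "e \<in> edges \<Gamma>" using cycle_subset[OF assms(1)] assms(2) by blast
  have "v \<in> verts \<Gamma>" using finite_mgraphD(3)[OF fin e] assms(3) by blast
  moreover have ei: "e \<in> incident \<Gamma> v c" using assms by (simp add: incident_def)
  ultimately have "card (incident \<Gamma> v c) = 2"
    using assms(1) unfolding cycle_def cyclic_set_def by blast
  then obtain a b where ab: "incident \<Gamma> v c = {a, b}" "a \<noteq> b" by (meson card_2_iff)
  with ei have "e = a \<or> e = b" by blast
  then obtain f where f: "incident \<Gamma> v c = {e, f}" "f \<noteq> e" using ab by blast
  then have "f \<in> incident \<Gamma> v c" by simp
  then have "f \<in> c" "v \<in> ends \<Gamma> f" by (simp_all add: incident_def)
  then show ?thesis using that f by blast
qed

text \<open>Adjacent labels on the cycle add up to \<open>1\<close>.  If they were not all \<open>1/2\<close>, those above \<open>1/2\<close> and those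
  below would alternate, which is impossible on an odd cycle.\<close>

lemma odd_cycle_half:
  assumes l: "l \<in> dimer_labelings \<Gamma>" and c: "odd_cycle \<Gamma> c" and pos: "\<And>e. e \<in> c \<Longrightarrow> 0 < l e"
    and e: "e \<in> c"
  shows "l e = 1/2"
proof (rule ccontr)
  assume ne: "l e \<noteq> 1/2"
  have circ: "forms_circle \<Gamma> c" and sub: "c \<subseteq> edges \<Gamma>"
    using c cycle_subset by (auto simp: odd_cycle_def cycle_def)
  have pair: "l f + l g = 1" if "f \<in> c" "g \<in> c" "f \<noteq> g" "ends \<Gamma> f \<inter> ends \<Gamma> g \<noteq> {}" for f g
    using dimer_labeling_pair[OF l] that pos sub by blast
  have all: "l f \<noteq> 1/2" if "f \<in> c" for f
    using circ e ne _ that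
  proof (rule circle_induct)
    fix f g assume "f \<in> c" "g \<in> c" "l f \<noteq> 1/2" "ends \<Gamma> f \<inter> ends \<Gamma> g \<noteq> {}"
    then show "l g \<noteq> 1/2" using pair[of f g] by (cases "f = g") auto
  qed
  have "alternating \<Gamma> c {f. l f > 1/2}"
    unfolding alternating_def
  proof (intro ballI impI)
    fix f g assume "f \<in> c" "g \<in> c" "f \<noteq> g \<and> ends \<Gamma> f \<inter> ends \<Gamma> g \<noteq> {}"
    then have "l f + l g = 1" "l f \<noteq> 1/2" using pair all by blast+
    then show "(f \<in> {f. l f > 1/2}) = (g \<notin> {f. l f > 1/2})" by auto
  qed
  then have "even (card c)" by (rule alternating_imp_even[OF circ])
  then show False using c by (simp add: odd_cycle_def)
qed

lemma continuous_map_label: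
  assumes "e \<in> edges \<Gamma>"
  shows "continuous_map (labeling_space \<Gamma>) euclideanreal (\<lambda>l. l e)"
  unfolding labeling_space_def
  by (intro continuous_map_from_subtopology
      continuous_map_into_fulltopology[OF continuous_map_product_projection[OF assms]])

text \<open>The conditions \<open>l e = 1/2\<close> on the edges \<open>e\<close> of an odd cycle are closed; they are equivalent to the open
  conditions \<open>l e > 0\<close> on the same edges.\<close>

lemma odd_labelings_clopen:
  assumes c: "odd_cycle \<Gamma> c"
  shows "closedin (labeling_space \<Gamma>) {l \<in> dimer_labelings \<Gamma>. \<forall>e\<in>c. l e = 1/2}"
    and "openin (labeling_space \<Gamma>) {l \<in> dimer_labelings \<Gamma>. \<forall>e\<in>c. l e = 1/2}"
proof -
  let ?X = "labeling_space \<Gamma>"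
  have cyc: "cycle \<Gamma> c" and sub: "c \<subseteq> edges \<Gamma>" using c cycle_subset by (auto simp: odd_cycle_def)
  have ne: "c \<noteq> {}" and finc: "finite c"
    using cycle_nonempty[OF cyc] finite_subset[OF sub finite_mgraphD(1)[OF fin]] by auto
  have "closedin ?X (\<Inter>e\<in>c. {l \<in> topspace ?X. l e \<in> {1/2}})"
    by (intro closedin_INT ne closedin_continuous_map_preimage[where Y = euclideanreal]
        continuous_map_label) (use sub in auto)
  moreover have "(\<Inter>e\<in>c. {l \<in> topspace ?X. l e \<in> {1/2}}) = {l \<in> dimer_labelings \<Gamma>. \<forall>e\<in>c. l e = 1/2}"
    using ne by (auto simp: topspace_labeling_space)
  ultimately show "closedin ?X {l \<in> dimer_labelings \<Gamma>. \<forall>e\<in>c. l e = 1/2}" by simp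
  have "openin ?X (\<Inter>e\<in>c. {l \<in> topspace ?X. l e \<in> {0<..}})"
    by (intro openin_INT2 finc ne openin_continuous_map_preimage[where Y = euclideanreal]
        continuous_map_label) (use sub in auto)
  moreover have "(\<Inter>e\<in>c. {l \<in> topspace ?X. l e \<in> {0<..}}) = {l \<in> dimer_labelings \<Gamma>. \<forall>e\<in>c. l e = 1/2}"
  proof (intro subset_antisym subsetI)
    fix l assume "l \<in> (\<Inter>e\<in>c. {l \<in> topspace ?X. l e \<in> {0<..}})"
    then have "l \<in> dimer_labelings \<Gamma>" "\<And>e. e \<in> c \<Longrightarrow> 0 < l e"
      using ne by (auto simp: topspace_labeling_space)
    then show "l \<in> {l \<in> dimer_labelings \<Gamma>. \<forall>e\<in>c. l e = 1/2}"
      using odd_cycle_half[OF _ c] by blast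
  qed (auto simp: topspace_labeling_space)
  ultimately show "openin ?X {l \<in> dimer_labelings \<Gamma>. \<forall>e\<in>c. l e = 1/2}" by simp
qed

lemma path_component_odd_cycles_of:
  assumes "path_component_of (labeling_space \<Gamma>) l l'"
  shows "odd_cycles_of \<Gamma> l = odd_cycles_of \<Gamma> l'"
proof -
  let ?X = "labeling_space \<Gamma>"
  let ?C = "Collect (path_component_of ?X l)"
  have conn: "connectedin ?X ?C"
    by (simp add: path_connectedin_imp_connectedin path_connectedin_path_component_of)
  have L: "l \<in> dimer_labelings \<Gamma>" "l' \<in> dimer_labelings \<Gamma>"
    using assms path_component_of_equiv[of ?X l l'] topspace_labeling_space by auto
  then have ll: "l \<in> ?C" "l' \<in> ?C"
    using assms by (simp_all add: path_component_of_refl topspace_labeling_space)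
  have "c \<in> odd_cycles_of \<Gamma> l \<longleftrightarrow> c \<in> odd_cycles_of \<Gamma> l'" for c
  proof (cases "odd_cycle \<Gamma> c")
    case True
    from connectedin_clopen_cases[OF conn odd_labelings_clopen[OF True]]
    show ?thesis using ll L True by (auto simp: odd_cycles_of_def disjnt_iff)
  qed (simp add: odd_cycles_of_def)
  then show ?thesis by blast
qed

end

section \<open>From based cubes to labelings\<close>

definition dimer_cubes :: "('v, 'e) mgraph \<Rightarrow> ('e set \<times> 'e set set) set" where
  "dimer_cubes \<Gamma> = {c \<in> based_cubes \<Gamma>. cube_vertices \<Gamma> c \<subseteq> dimer_coverings \<Gamma>}"

text \<open>The cycles in a based cube are disjoint, so the sum has at most one term.  Written as a sum, the
  weight does not change when a coordinate with value \<open>0\<close> is dropped.\<close>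

definition cube_weight :: "'e set set \<Rightarrow> ('e set \<Rightarrow> real) \<Rightarrow> 'e \<Rightarrow> real" where
  "cube_weight S x e = (\<Sum>s\<in>{s \<in> S. e \<in> s}. x s)"

text \<open>Coordinate \<open>x s\<close> measures how far the cycle \<open>s\<close> has been switched: on \<open>s\<close> the labels move linearly from the
  indicator of \<open>A\<close> (at \<open>x s = 0\<close>) to the indicator of its complement (at \<open>x s = 1\<close>).  The formula makes
  sense on all based cubes, whether or not their vertices are dimer coverings.\<close>

definition cube_labeling ::
    "('v, 'e) mgraph \<Rightarrow> ('e set \<times> 'e set set) \<times> ('e set \<Rightarrow> real) \<Rightarrow> 'e \<Rightarrow> real" where
  "cube_labeling \<Gamma> = (\<lambda>((A, S), x). \<lambda>e\<in>edges \<Gamma>.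
     if e \<in> A then 1 - cube_weight S x e else cube_weight S x e)"

lemma cube_labeling_apply:
  "e \<in> edges \<Gamma> \<Longrightarrow> cube_labeling \<Gamma> ((A, S), x) e =
     (if e \<in> A then 1 - cube_weight S x e else cube_weight S x e)"
  by (simp add: cube_labeling_def)

lemma cube_labeling_extensional: "cube_labeling \<Gamma> p \<in> extensional (edges \<Gamma>)"
  by (auto simp: cube_labeling_def split: prod.split)

lemma mem_incident_eq: "\<lbrakk>incident \<Gamma> v s = X; v \<in> ends \<Gamma> g\<rbrakk> \<Longrightarrow> g \<in> s \<longleftrightarrow> g \<in> X"
  by (auto simp: incident_def)

lemma incident_eq_singleton:
  "\<lbrakk>\<And>g. v \<in> ends \<Gamma> g \<Longrightarrow> g \<in> s \<longleftrightarrow> g = c; v \<in> ends \<Gamma> c\<rbrakk> \<Longrightarrow> incident \<Gamma> v s = {c}"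
  by (auto simp: incident_def)

lemma cube_weight_outside: "e \<notin> \<Union>S \<Longrightarrow> cube_weight S x e = 0"
  by (auto simp: cube_weight_def intro!: sum.neutral)

lemma mem_cube_sum:
  "((A, S), x) \<in> topspace (cube_sum \<Gamma>) \<longleftrightarrow> (A, S) \<in> based_cubes \<Gamma> \<and> x \<in> S \<rightarrow>\<^sub>E {0..1}"
  by (auto simp: cube_sum_def)

context
  fixes \<Gamma> :: "('v, 'e) mgraph"
  assumes fin: "finite_mgraph \<Gamma>"
begin

lemma based_cubesD:
  assumes "(A, S) \<in> based_cubes \<Gamma>"
  shows "A \<subseteq> edges \<Gamma>" "finite S" "\<And>s. s \<in> S \<Longrightarrow> cycle \<Gamma> s" "\<And>s. s \<in> S \<Longrightarrow> s \<subseteq> edges \<Gamma>"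
    "\<And>s. s \<in> S \<Longrightarrow> even_cycle \<Gamma> s"
  using assms cycle_subset by (auto simp: based_cubes_def power_group_def even_cycle_def)

lemma based_cubes_same:
  assumes "(A, S) \<in> based_cubes \<Gamma>" "s \<in> S" "t \<in> S" "e \<in> s" "f \<in> t"
    "ends \<Gamma> e \<inter> ends \<Gamma> f \<noteq> {}"
  shows "s = t"
  using assms unfolding based_cubes_def pairwise_def independent_edges_def by blast

lemma based_cubes_disjoint:
  assumes "(A, S) \<in> based_cubes \<Gamma>" "s \<in> S" "t \<in> S" "e \<in> s" "e \<in> t"
  shows "s = t"
proof -
  have "ends \<Gamma> e \<noteq> {}" using finite_mgraphD(4)[OF fin] based_cubesD(4)[OF assms(1,2)] assms(4) by blast
  then show ?thesis using based_cubes_same[OF assms] by simp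
qed

lemma cube_weight_inside:
  assumes "(A, S) \<in> based_cubes \<Gamma>" "s \<in> S" "e \<in> s"
  shows "cube_weight S x e = x s"
proof -
  have "{t \<in> S. e \<in> t} = {s}" using assms based_cubes_disjoint[OF assms(1)] by blast
  then show ?thesis by (simp add: cube_weight_def)
qed

text \<open>For disjoint cycles the product in the power group is the union.\<close>

lemma mem_slide_iff:
  assumes "(A, S) \<in> based_cubes \<Gamma>" "T \<subseteq> S"
  shows "e \<in> slide \<Gamma> T A \<longleftrightarrow> (e \<in> \<Union>T) \<noteq> (e \<in> A)"
proof -
  interpret comm_group "power_group \<Gamma>" by (rule comm_group_power_group)
  have finT: "finite T" using assms based_cubesD(2) finite_subset by blast
  have "finprod (power_group \<Gamma>) (\<lambda>s. s) T = \<Union>T"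
    using finT assms(2)
  proof (induction T)
    case (insert s T)
    have "s \<inter> \<Union>T = {}"
      using insert.hyps insert.prems based_cubes_disjoint[OF assms(1)] by blast
    moreover have "t \<in> carrier (power_group \<Gamma>)" if "t \<in> insert s T" for t
      using based_cubesD(4)[OF assms(1)] insert.prems that by (auto simp: power_group_def)
    ultimately show ?case
      using insert finprod_insert[of T s "\<lambda>s. s"] by (auto simp: power_group_def)
  next
    case empty
    have "\<one>\<^bsub>power_group \<Gamma>\<^esub> = {}" by (simp add: power_group_def)
    then show ?case using finprod_empty[of "\<lambda>s. s"] by simp
  qed
  then show ?thesis by (auto simp: slide_def power_group_def)
qed

lemma slide_based:
  assumes "(A, S) \<in> based_cubes \<Gamma>" "T \<subseteq> S"
  shows "(slide \<Gamma> T A, S) \<in> based_cubes \<Gamma>"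
proof -
  have "slide \<Gamma> T A \<subseteq> edges \<Gamma>"
    using mem_slide_iff[OF assms] based_cubesD[OF assms(1)] assms(2) by blast
  then show ?thesis using assms(1) by (simp add: based_cubes_def power_group_def)
qed

text \<open>Rebasing along \<open>T\<close> replaces on \<open>\<Union>T\<close> both the indicator of \<open>A\<close> and the weight by their complements to \<open>1\<close>, and
  the two changes cancel.\<close>

lemma cube_labeling_glue:
  assumes "cube_glue \<Gamma> p q"
  shows "cube_labeling \<Gamma> p = cube_labeling \<Gamma> q"
  using assms
proof cases
  case (face A S x S' x')
  then have "finite S'" using based_cubesD(2)[of A S'] mem_cube_sum by blast
  have "cube_weight S x e = cube_weight S' x' e" for e
  proof -
    have "cube_weight S x e = (\<Sum>s\<in>{s \<in> S. e \<in> s}. x' s)"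
      unfolding cube_weight_def by (rule sum.cong) (use face in auto)
    also have "\<dots> = cube_weight S' x' e"
      unfolding cube_weight_def
      by (rule sum.mono_neutral_left) (use face \<open>finite S'\<close> in auto)
    finally show ?thesis .
  qed
  then have "cube_weight S x = cube_weight S' x'" by (rule ext)
  then show ?thesis using face by (simp add: cube_labeling_def cong: if_cong)
next
  case (rebase A S x T x')
  have b: "(A, S) \<in> based_cubes \<Gamma>" using rebase mem_cube_sum by blast
  show ?thesis
  proof (rule extensionalityI[OF cube_labeling_extensional cube_labeling_extensional])
    fix e assume e: "e \<in> edges \<Gamma>"
    have w: "cube_weight S x' e = (if e \<in> \<Union>T then 1 - cube_weight S x e else cube_weight S x e)"
    proof (cases "e \<in> \<Union>S")
      case True
      then obtain s where s: "s \<in> S" "e \<in> s" by blast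
      have "e \<in> \<Union>T \<longleftrightarrow> s \<in> T" using s rebase(5) based_cubes_disjoint[OF b] by blast
      then show ?thesis using cube_weight_inside[OF b s] rebase s by auto
    next
      case False
      then show ?thesis using rebase(5) cube_weight_outside[of e S] by auto
    qed
    show "cube_labeling \<Gamma> p e = cube_labeling \<Gamma> q e"
      using rebase w e mem_slide_iff[OF b rebase(5), of e] by (auto simp: cube_labeling_apply)
  qed
qed

lemma cube_labeling_equiv:
  assumes "equivclp (cube_glue \<Gamma>) p q"
  shows "cube_labeling \<Gamma> p = cube_labeling \<Gamma> q"
  using assms by (induction rule: equivclp_induct) (auto dest: cube_labeling_glue)

lemma dimer_coverings_iff:
  "A \<in> dimer_coverings \<Gamma> \<longleftrightarrow> A \<subseteq> edges \<Gamma> \<and> (\<forall>v\<in>verts \<Gamma>. \<exists>a. incident \<Gamma> v A = {a})"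
  by (auto simp: dimer_coverings_def dimer_covering_def card_1_singleton_iff)

text \<open>For a dimer covering \<open>A\<close>, switching a cycle \<open>s\<close> gives again a dimer covering exactly when, at each vertex of \<open>s\<close>,
  the edge of \<open>A\<close> is one of the two edges of \<open>s\<close>.  Since the cycles are independent, the switches do not
  interfere.\<close>

lemma dimer_cubes_iff:
  "(A, S) \<in> dimer_cubes \<Gamma> \<longleftrightarrow>
     (A, S) \<in> based_cubes \<Gamma> \<and> A \<in> dimer_coverings \<Gamma> \<and> (\<forall>s\<in>S. alternating \<Gamma> s A)"
proof (intro iffI conjI ballI)
  assume d: "(A, S) \<in> dimer_cubes \<Gamma>"
  then show b: "(A, S) \<in> based_cubes \<Gamma>" by (simp add: dimer_cubes_def)
  have sl: "slide \<Gamma> T A \<in> dimer_coverings \<Gamma>" if "T \<subseteq> S" for T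
    using d that by (auto simp: dimer_cubes_def cube_vertices_def)
  have "slide \<Gamma> {} A = A" using mem_slide_iff[OF b, of "{}"] by auto
  then show A: "A \<in> dimer_coverings \<Gamma>" using sl[of "{}"] by simp
  fix s assume s: "s \<in> S"
  show "alternating \<Gamma> s A"
    unfolding alternating_def
  proof (intro ballI impI, elim conjE)
    fix e f assume ef: "e \<in> s" "f \<in> s" "e \<noteq> f" "ends \<Gamma> e \<inter> ends \<Gamma> f \<noteq> {}"
    then obtain v where v: "v \<in> ends \<Gamma> e" "v \<in> ends \<Gamma> f" by blast
    have e: "e \<in> edges \<Gamma>" using based_cubesD(4)[OF b s] ef by blast
    have vV: "v \<in> verts \<Gamma>" using finite_mgraphD(3)[OF fin e] v by blast
    obtain a where a: "incident \<Gamma> v A = {a}" using A vV unfolding dimer_coverings_iff by blast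
    obtain c where c: "incident \<Gamma> v (slide \<Gamma> {s} A) = {c}"
      using sl[of "{s}"] s vV unfolding dimer_coverings_iff by blast
    have "g \<in> A \<longleftrightarrow> g = a" "g \<in> slide \<Gamma> {s} A \<longleftrightarrow> g = c" if "v \<in> ends \<Gamma> g" for g
      using mem_incident_eq[OF a that] mem_incident_eq[OF c that] by simp_all
    moreover have "g \<in> slide \<Gamma> {s} A \<longleftrightarrow> (g \<in> s) \<noteq> (g \<in> A)" for g
      using mem_slide_iff[OF b, of "{s}" g] s by simp
    ultimately show "(e \<in> A) = (f \<notin> A)" using v ef by metis
  qed
next
  assume R: "(A, S) \<in> based_cubes \<Gamma> \<and> A \<in> dimer_coverings \<Gamma> \<and> (\<forall>s\<in>S. alternating \<Gamma> s A)"
  then have b: "(A, S) \<in> based_cubes \<Gamma>" by blast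
  have "slide \<Gamma> T A \<in> dimer_coverings \<Gamma>" if T: "T \<subseteq> S" for T
    unfolding dimer_coverings_iff
  proof (intro conjI ballI)
    show "slide \<Gamma> T A \<subseteq> edges \<Gamma>" using based_cubesD(1)[OF slide_based[OF b T]] .
    fix v assume v: "v \<in> verts \<Gamma>"
    obtain a where av: "incident \<Gamma> v A = {a}" using R v unfolding dimer_coverings_iff by blast
    then have a: "g \<in> A \<longleftrightarrow> g = a" if "v \<in> ends \<Gamma> g" for g
      using mem_incident_eq[OF av that] by simp
    show "\<exists>c. incident \<Gamma> v (slide \<Gamma> T A) = {c}"
    proof (cases "\<exists>s\<in>T. \<exists>e\<in>s. v \<in> ends \<Gamma> e")
      case True
      then obtain s e where s: "s \<in> T" "e \<in> s" "v \<in> ends \<Gamma> e" by blast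
      have sS: "s \<in> S" using s T by blast
      obtain f where f: "f \<in> s" "f \<noteq> e" "v \<in> ends \<Gamma> f" "incident \<Gamma> v s = {e, f}"
        using cycle_incident[OF fin based_cubesD(3)[OF b sS] s(2,3)] by metis
      have sg: "g \<in> s \<longleftrightarrow> g = e \<or> g = f" if "v \<in> ends \<Gamma> g" for g
        using mem_incident_eq[OF f(4) that] by simp
      have Tg: "g \<in> \<Union>T \<longleftrightarrow> g \<in> s" if "v \<in> ends \<Gamma> g" for g
        using s T that based_cubes_same[OF b sS _ s(2)] by blast
      have "e \<in> A \<longleftrightarrow> f \<notin> A"
        using R sS s f unfolding alternating_def by blast
      then have "g \<in> slide \<Gamma> T A \<longleftrightarrow> g = (if e \<in> A then f else e)" if "v \<in> ends \<Gamma> g" for g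
        using mem_slide_iff[OF b T, of g] sg[OF that] Tg[OF that] a[OF that] a[OF s(3)] a[OF f(3)] f(2)
        by auto
      then have "incident \<Gamma> v (slide \<Gamma> T A) = {if e \<in> A then f else e}"
        by (rule incident_eq_singleton) (use s(3) f(3) in auto)
      then show ?thesis by blast
    next
      case False
      then have "incident \<Gamma> v (slide \<Gamma> T A) = incident \<Gamma> v A"
        using mem_slide_iff[OF b T] by (auto simp: incident_def)
      then show ?thesis using av by simp
    qed
  qed
  then show "(A, S) \<in> dimer_cubes \<Gamma>"
    using b by (auto simp: dimer_cubes_def cube_vertices_def)
qed

text \<open>At a vertex of a cycle \<open>s \<in> S\<close> the labels are \<open>1 - x s\<close> on the edge of \<open>A\<close>, \<open>x s\<close> on the other edge of \<open>s\<close>, and \<open>0\<close>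
  elsewhere; at any other vertex they are the indicator of \<open>A\<close>.\<close>

lemma cube_labeling_in:
  assumes c: "(A, S) \<in> dimer_cubes \<Gamma>" and x: "\<And>s. s \<in> S \<Longrightarrow> 0 \<le> x s \<and> x s \<le> 1"
  shows "cube_labeling \<Gamma> ((A, S), x) \<in> dimer_labelings \<Gamma>"
  unfolding dimer_labelings_iff[OF fin]
proof (intro conjI ballI cube_labeling_extensional)
  let ?l = "cube_labeling \<Gamma> ((A, S), x)"
  have b: "(A, S) \<in> based_cubes \<Gamma>" and A: "A \<in> dimer_coverings \<Gamma>"
    and alt: "\<And>s. s \<in> S \<Longrightarrow> alternating \<Gamma> s A" using c dimer_cubes_iff by auto
  fix v assume v: "v \<in> verts \<Gamma>"
  let ?I = "incident \<Gamma> v (edges \<Gamma>)"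
  obtain a where av: "incident \<Gamma> v A = {a}" using A v unfolding dimer_coverings_iff by blast
  then have a: "g \<in> A \<longleftrightarrow> g = a" if "v \<in> ends \<Gamma> g" for g
    using mem_incident_eq[OF av that] by simp
  have "a \<in> incident \<Gamma> v A" using av by simp
  then have aI: "a \<in> ?I" "v \<in> ends \<Gamma> a" using based_cubesD(1)[OF b] by (auto simp: incident_def)
  have off: "?l g = (if g = a then 1 else 0)" if "g \<in> ?I" "g \<notin> \<Union>S" for g
    using that a by (auto simp: incident_def cube_labeling_apply cube_weight_outside)
  show "splits_one ?l ?I"
  proof (cases "\<exists>s\<in>S. \<exists>e\<in>s. v \<in> ends \<Gamma> e")
    case True
    then obtain s e where s: "s \<in> S" "e \<in> s" "v \<in> ends \<Gamma> e" by blast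
    obtain f where f: "f \<in> s" "f \<noteq> e" "v \<in> ends \<Gamma> f" "incident \<Gamma> v s = {e, f}"
      using cycle_incident[OF fin based_cubesD(3)[OF b s(1)] s(2,3)] by metis
    have "e \<in> A \<longleftrightarrow> f \<notin> A" using alt s f unfolding alternating_def by blast
    then have "a = e \<or> a = f" using a s f by metis
    then obtain h where h: "incident \<Gamma> v s = {a, h}" "h \<noteq> a" using f by (metis insert_commute)
    have "a \<in> incident \<Gamma> v s" "h \<in> incident \<Gamma> v s" using h by simp_all
    then have ah: "a \<in> s" "h \<in> s" "v \<in> ends \<Gamma> h" by (simp_all add: incident_def)
    have hI: "h \<in> ?I" using ah based_cubesD(4)[OF b s(1)] by (auto simp: incident_def)
    have la: "?l a = 1 - x s"
      using aI a[OF aI(2)] cube_weight_inside[OF b s(1) ah(1)] by (simp add: incident_def cube_labeling_apply)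
    have lh: "?l h = x s"
      using hI a[OF ah(3)] h(2) cube_weight_inside[OF b s(1) ah(2)] by (simp add: incident_def cube_labeling_apply)
    have z: "?l g = 0" if g: "g \<in> ?I" "g \<noteq> a" "g \<noteq> h" for g
    proof -
      have "v \<in> ends \<Gamma> g" using g by (simp add: incident_def)
      moreover have "g \<notin> s" using mem_incident_eq[OF h(1)] g calculation by simp
      ultimately have "g \<notin> \<Union>S" using based_cubes_same[OF b _ s(1) _ s(2)] s(3) by blast
      then show ?thesis using off g by simp
    qed
    consider "x s = 0" | "x s = 1" | "0 < x s" "x s < 1" using x[OF s(1)] by fastforce
    then show ?thesis
    proof cases
      case 1
      show ?thesis by (rule splits_one_singleI[OF aI(1)]) (use la lh z 1 in auto)
    next
      case 2
      show ?thesis by (rule splits_one_singleI[OF hI]) (use la lh z 2 in auto)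
    next
      case 3
      show ?thesis by (rule splits_one_pairI[OF aI(1) hI h(2)[symmetric]]) (use la lh z 3 in auto)
    qed
  next
    case False
    then have "g \<notin> \<Union>S" if "g \<in> ?I" for g using that by (auto simp: incident_def)
    then show ?thesis by (intro splits_one_singleI[OF aI(1)]) (use off aI(1) in auto)
  qed
qed

end

section \<open>The dimer complex is the component of the dimer coverings\<close>

lemma continuous_map_from_sum_topology:
  assumes "\<And>i. i \<in> I \<Longrightarrow> continuous_map (X i) Y (\<lambda>x. f (i, x))"
  shows "continuous_map (sum_topology X I) Y f"
proof -
  have "openin (sum_topology X I) {p \<in> topspace (sum_topology X I). f p \<in> V}" if V: "openin Y V" for V
    unfolding openin_sum_topology
  proof (intro conjI ballI)
    fix i assume i: "i \<in> I"
    have "{x. (i, x) \<in> {p \<in> topspace (sum_topology X I). f p \<in> V}} = {x \<in> topspace (X i). f (i, x) \<in> V}"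
      using i by auto
    then show "openin (X i) {x. (i, x) \<in> {p \<in> topspace (sum_topology X I). f p \<in> V}}"
      using openin_continuous_map_preimage[OF assms[OF i] V] by simp
  qed auto
  moreover have "f p \<in> topspace Y" if "p \<in> topspace (sum_topology X I)" for p
    using that continuous_map_funspace[OF assms] by (cases p) fastforce
  ultimately show ?thesis by (auto simp: continuous_map_def)
qed

context
  fixes \<Gamma> :: "('v, 'e) mgraph"
  assumes fin: "finite_mgraph \<Gamma>"
begin

text \<open>Coordinates equal to \<open>1\<close> are turned into \<open>0\<close> by rebasing, and coordinates equal to \<open>0\<close> are then dropped by
  passing to a face.\<close>

lemma dimer_point_reduced:
  assumes c: "(A, S) \<in> dimer_cubes \<Gamma>" and x: "x \<in> S \<rightarrow>\<^sub>E {0..1}"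
  obtains B R y where "(B, R) \<in> dimer_cubes \<Gamma>" "y \<in> R \<rightarrow>\<^sub>E {0<..<1}"
    "equivclp (cube_glue \<Gamma>) ((A, S), x) ((B, R), y)"
proof -
  have b: "(A, S) \<in> based_cubes \<Gamma>" using c by (simp add: dimer_cubes_def)
  define T where "T = {s \<in> S. x s = 1}"
  define B where "B = slide \<Gamma> T A"
  define x' where "x' = (\<lambda>s\<in>S. if s \<in> T then 0 else x s)"
  define R where "R = {s \<in> S. 0 < x s \<and> x s < 1}"
  define y where "y = restrict x' R"
  have T: "T \<subseteq> S" and R: "R \<subseteq> S" by (auto simp: T_def R_def)
  have bB: "(B, S) \<in> based_cubes \<Gamma>" using slide_based[OF fin b T] by (simp add: B_def)
  then have bR: "(B, R) \<in> based_cubes \<Gamma>"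
    using R finite_subset[OF R] by (auto simp: based_cubes_def intro: pairwise_subset)
  have x01: "0 \<le> x s" "x s \<le> 1" if "s \<in> S" for s using x that by auto
  have "cube_glue \<Gamma> ((A, S), x) ((slide \<Gamma> T A, S), x')"
    by (rule rebase) (use b bB x T x01 in \<open>auto simp: mem_cube_sum B_def x'_def T_def\<close>)
  then have g1: "equivclp (cube_glue \<Gamma>) ((A, S), x) ((B, S), x')"
    unfolding B_def by (rule r_into_equivclp)
  have "cube_glue \<Gamma> ((B, R), y) ((B, S), x')"
  proof (rule face)
    show "\<forall>s\<in>S - R. x' s = 0"
      using x01 by (force simp: x'_def R_def T_def)
  qed (use bB bR R x01 in \<open>auto simp: mem_cube_sum y_def x'_def\<close>)
  then have g2: "equivclp (cube_glue \<Gamma>) ((B, S), x') ((B, R), y)"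
    by (simp add: equivclp_sym r_into_equivclp)
  have yR: "y \<in> R \<rightarrow>\<^sub>E {0<..<1}"
  proof (rule PiE_I)
    fix s assume "s \<in> R"
    then have "s \<in> S" "s \<notin> T" "0 < x s" "x s < 1" by (auto simp: R_def T_def)
    then show "y s \<in> {0<..<1}" using \<open>s \<in> R\<close> by (simp add: y_def x'_def)
  qed (simp add: y_def)
  have "(B, R) \<in> dimer_cubes \<Gamma>"
    unfolding dimer_cubes_iff[OF fin]
  proof (intro conjI ballI bR)
    show "B \<in> dimer_coverings \<Gamma>"
      using c T by (auto simp: dimer_cubes_def cube_vertices_def B_def)
    fix s assume s: "s \<in> R"
    then have sS: "s \<in> S" and sT: "s \<notin> T" by (auto simp: R_def T_def)
    have "e \<in> B \<longleftrightarrow> e \<in> A" if "e \<in> s" for e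
      using mem_slide_iff[OF fin b T, of e] based_cubes_disjoint[OF fin b sS _ that] T sT
      by (auto simp: B_def)
    moreover have "alternating \<Gamma> s A" using c sS dimer_cubes_iff[OF fin] by blast
    ultimately show "alternating \<Gamma> s B" by (simp add: alternating_def)
  qed
  then show ?thesis using that yR equivclp_trans[OF g1 g2] by blast
qed

lemma based_cubes_cycle_subset:
  assumes bS: "(A, S) \<in> based_cubes \<Gamma>" and bR: "(B, R) \<in> based_cubes \<Gamma>" and U: "\<Union>S \<subseteq> \<Union>R"
    and s: "s \<in> S" and t: "t \<in> R" and e: "e \<in> s" "e \<in> t"
  shows "s \<subseteq> t"
proof
  fix f assume f: "f \<in> s"
  have "forms_circle \<Gamma> s" using based_cubesD(3)[OF fin bS s] by (simp add: cycle_def)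
  then show "f \<in> t"
    using e(1) e(2) _ f
  proof (rule circle_induct)
    fix g h assume g: "g \<in> s" "h \<in> s" "g \<in> t" "ends \<Gamma> g \<inter> ends \<Gamma> h \<noteq> {}"
    then obtain t' where t': "t' \<in> R" "h \<in> t'" using U s by blast
    then show "h \<in> t" using based_cubes_same[OF fin bR t t'(1) g(3) t'(2) g(4)] by simp
  qed
qed

text \<open>The cycles of a based cube are the connected components of their union, so the union determines them.\<close>

lemma based_cubes_cycles_subset:
  assumes bS: "(A, S) \<in> based_cubes \<Gamma>" and bR: "(B, R) \<in> based_cubes \<Gamma>" and U: "\<Union>S = \<Union>R"
  shows "S \<subseteq> R"
proof
  fix s assume s: "s \<in> S"
  obtain e where e: "e \<in> s" using cycle_nonempty[OF based_cubesD(3)[OF fin bS s]] by blast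
  then obtain t where t: "t \<in> R" "e \<in> t" using U s by blast
  have "s \<subseteq> t" using based_cubes_cycle_subset[OF bS bR _ s t(1) e t(2)] U by simp
  moreover have "t \<subseteq> s" using based_cubes_cycle_subset[OF bR bS _ t(1) s t(2) e] U by simp
  ultimately show "s \<in> R" using t(1) by simp
qed

lemma cube_labeling_fractional_edges:
  assumes b: "(A, S) \<in> based_cubes \<Gamma>" and x: "x \<in> S \<rightarrow>\<^sub>E {0<..<1}"
  shows "fractional_edges \<Gamma> (cube_labeling \<Gamma> ((A, S), x)) = \<Union>S"
proof -
  have "e \<in> fractional_edges \<Gamma> (cube_labeling \<Gamma> ((A, S), x)) \<longleftrightarrow> e \<in> \<Union>S" if e: "e \<in> edges \<Gamma>" for e
  proof (cases "e \<in> \<Union>S")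
    case True
    then obtain s where s: "s \<in> S" "e \<in> s" by blast
    then have "0 < x s" "x s < 1" using x by auto
    then show ?thesis
      using s e cube_weight_inside[OF fin b s, of x] by (auto simp: fractional_edges_def cube_labeling_apply)
  next
    case False
    then show ?thesis using e by (auto simp: fractional_edges_def cube_labeling_apply cube_weight_outside)
  qed
  moreover have "\<Union>S \<subseteq> edges \<Gamma>" using based_cubesD(4)[OF fin b] by blast
  moreover have "fractional_edges \<Gamma> (cube_labeling \<Gamma> ((A, S), x)) \<subseteq> edges \<Gamma>"
    by (auto simp: fractional_edges_def)
  ultimately show ?thesis by blast
qed

text \<open>The labels strictly between \<open>0\<close> and \<open>1\<close> determine \<open>\<Union>S\<close>, hence \<open>S\<close>.  Off \<open>\<Union>S\<close> the sets \<open>A\<close> and \<open>B\<close> agree with the edges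
  labelled \<open>1\<close>.  On each cycle \<open>A\<close> and \<open>B\<close> are both alternating, so they coincide or are complementary there;
  rebasing along the cycles of the second kind turns one point into the other.\<close>

lemma cube_labeling_inj_reduced:
  assumes cS: "(A, S) \<in> dimer_cubes \<Gamma>" and x: "x \<in> S \<rightarrow>\<^sub>E {0<..<1}"
    and cR: "(B, R) \<in> dimer_cubes \<Gamma>" and y: "y \<in> R \<rightarrow>\<^sub>E {0<..<1}"
    and eq: "cube_labeling \<Gamma> ((A, S), x) = cube_labeling \<Gamma> ((B, R), y)"
  shows "equivclp (cube_glue \<Gamma>) ((A, S), x) ((B, R), y)"
proof -
  have bS: "(A, S) \<in> based_cubes \<Gamma>" and bR: "(B, R) \<in> based_cubes \<Gamma>"
    using cS cR by (simp_all add: dimer_cubes_def)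
  have U: "\<Union>S = \<Union>R"
    using cube_labeling_fractional_edges[OF bS x] cube_labeling_fractional_edges[OF bR y] eq by simp
  have RS: "R = S"
    using based_cubes_cycles_subset[OF bS bR U] based_cubes_cycles_subset[OF bR bS U[symmetric]] by simp
  have alt: "alternating \<Gamma> s A" "alternating \<Gamma> s B" if "s \<in> S" for s
    using that cS cR RS dimer_cubes_iff[OF fin] by auto
  have val: "(if e \<in> A then 1 - x s else x s) = (if e \<in> B then 1 - y s else y s)"
    if "s \<in> S" "e \<in> s" for s e
  proof -
    have "e \<in> edges \<Gamma>" using based_cubesD(4)[OF fin bS] that by blast
    then show ?thesis
      using fun_cong[OF eq, of e] cube_weight_inside[OF fin bS that]
        cube_weight_inside[OF fin bR[unfolded RS] that] RS
      by (simp add: cube_labeling_apply split: if_splits)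
  qed
  \<comment> \<open>the cycles on which \<open>A\<close> and \<open>B\<close> are complementary\<close>
  define T where "T = {s \<in> S. \<exists>e\<in>s. (e \<in> A) \<noteq> (e \<in> B)}"
  have TS: "T \<subseteq> S" by (auto simp: T_def)
  have differ: "(e \<in> A) \<noteq> (e \<in> B)" if s: "s \<in> T" and e: "e \<in> s" for s e
  proof -
    have sS: "s \<in> S" using s by (simp add: T_def)
    obtain e0 where e0: "e0 \<in> s" "(e0 \<in> A) \<noteq> (e0 \<in> B)" using s by (auto simp: T_def)
    have "forms_circle \<Gamma> s" using based_cubesD(3)[OF fin bS sS] by (simp add: cycle_def)
    then show ?thesis
      using e0(1) e0(2) _ e
    proof (rule circle_induct)
      fix g h assume "g \<in> s" "h \<in> s" "(g \<in> A) \<noteq> (g \<in> B)" "ends \<Gamma> g \<inter> ends \<Gamma> h \<noteq> {}"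
      then show "(h \<in> A) \<noteq> (h \<in> B)"
        using alt[OF sS] unfolding alternating_def by (cases "g = h") blast+
    qed
  qed
  have sl: "slide \<Gamma> T A = B"
  proof (rule Set.set_eqI)
    fix e
    show "e \<in> slide \<Gamma> T A \<longleftrightarrow> e \<in> B"
    proof (cases "e \<in> \<Union>S")
      case True
      then obtain s where s: "s \<in> S" "e \<in> s" by blast
      have "e \<in> \<Union>T \<longleftrightarrow> s \<in> T" using s TS based_cubes_disjoint[OF fin bS] by blast
      also have "\<dots> \<longleftrightarrow> (e \<in> A) \<noteq> (e \<in> B)" using differ s by (auto simp: T_def)
      finally show ?thesis using mem_slide_iff[OF fin bS TS, of e] by blast
    next
      case False
      have "e \<in> A \<longleftrightarrow> e \<in> B"
      proof (cases "e \<in> edges \<Gamma>")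
        case True
        then show ?thesis
          using fun_cong[OF eq, of e] False cube_weight_outside[of e S] RS
          by (auto simp: cube_labeling_apply split: if_splits)
      next
        case False
        then show ?thesis using based_cubesD(1)[OF fin] bS bR by blast
      qed
      then show ?thesis using mem_slide_iff[OF fin bS TS, of e] False TS by blast
    qed
  qed
  have "cube_glue \<Gamma> ((A, S), x) ((slide \<Gamma> T A, S), y)"
  proof (rule rebase)
    have "x \<in> S \<rightarrow>\<^sub>E {0..1}" "y \<in> S \<rightarrow>\<^sub>E {0..1}"
      using x y RS by (auto simp: PiE_iff less_imp_le)
    then show "((A, S), x) \<in> topspace (cube_sum \<Gamma>)" "((slide \<Gamma> T A, S), y) \<in> topspace (cube_sum \<Gamma>)"
      using bS bR RS sl by (simp_all add: mem_cube_sum)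
    show "\<forall>s\<in>S - T. y s = x s"
    proof
      fix s assume s: "s \<in> S - T"
      obtain e where "e \<in> s" using s cycle_nonempty[OF based_cubesD(3)[OF fin bS]] by blast
      then show "y s = x s" using val[of s e] s by (auto simp: T_def split: if_splits)
    qed
    show "\<forall>t\<in>T. y t = 1 - x t"
    proof
      fix s assume s: "s \<in> T"
      obtain e where "e \<in> s" using s TS cycle_nonempty[OF based_cubesD(3)[OF fin bS]] by blast
      then show "y s = 1 - x s" using val[of s e] differ[OF s] s TS by (auto split: if_splits)
    qed
  qed (rule TS)
  then show ?thesis unfolding sl RS by (rule r_into_equivclp)
qed

lemma cube_labeling_inj:
  assumes "(A, S) \<in> dimer_cubes \<Gamma>" "x \<in> S \<rightarrow>\<^sub>E {0..1}" "(B, R) \<in> dimer_cubes \<Gamma>" "y \<in> R \<rightarrow>\<^sub>E {0..1}"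
    and eq: "cube_labeling \<Gamma> ((A, S), x) = cube_labeling \<Gamma> ((B, R), y)"
  shows "equivclp (cube_glue \<Gamma>) ((A, S), x) ((B, R), y)"
proof -
  obtain A' S' x' where 1: "(A', S') \<in> dimer_cubes \<Gamma>" "x' \<in> S' \<rightarrow>\<^sub>E {0<..<1}"
    "equivclp (cube_glue \<Gamma>) ((A, S), x) ((A', S'), x')" using dimer_point_reduced[OF assms(1,2)] .
  obtain B' R' y' where 2: "(B', R') \<in> dimer_cubes \<Gamma>" "y' \<in> R' \<rightarrow>\<^sub>E {0<..<1}"
    "equivclp (cube_glue \<Gamma>) ((B, R), y) ((B', R'), y')" using dimer_point_reduced[OF assms(3,4)] .
  have "equivclp (cube_glue \<Gamma>) ((A', S'), x') ((B', R'), y')"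
    using cube_labeling_inj_reduced[OF 1(1,2) 2(1,2)] cube_labeling_equiv[OF fin 1(3)]
      cube_labeling_equiv[OF fin 2(3)] eq by simp
  then show ?thesis using 1(3) 2(3) by (meson equivclp_sym equivclp_trans)
qed

text \<open>The edges with labels strictly between \<open>0\<close> and \<open>1\<close> split into cycles, which are even because no odd cycle
  of constant label \<open>1/2\<close> is present.  A two-colouring of each of them, together with the edges labelled
  \<open>1\<close>, gives a dimer covering \<open>A\<close>; the labels are constant on each colour class.\<close>

lemma cube_labeling_surj:
  assumes l: "l \<in> dimer_labelings \<Gamma>" and odd: "odd_cycles_of \<Gamma> l = {}"
  obtains A S x where "(A, S) \<in> dimer_cubes \<Gamma>" "x \<in> S \<rightarrow>\<^sub>E {0..1}" "cube_labeling \<Gamma> ((A, S), x) = l"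
proof -
  define H where "H = fractional_edges \<Gamma> l"
  have HE: "e \<in> edges \<Gamma>" "0 < l e" "l e < 1" if "e \<in> H" for e
    using that by (auto simp: H_def fractional_edges_def)
  have Hc: "cyclic_set \<Gamma> H" using fractional_edges_cyclic[OF fin l] by (simp add: H_def)
  define S where "S = edge_component \<Gamma> H ` H"
  have finS: "finite S" using Hc by (simp add: S_def cyclic_set_def)
  have sH: "s \<subseteq> H" if "s \<in> S" for s using that edge_component_subset by (fastforce simp: S_def)
  have US: "\<Union>S = H" using sH edge_component_self by (fastforce simp: S_def)
  have same: "s = t" if "s \<in> S" "t \<in> S" "e \<in> s" "f \<in> t" "ends \<Gamma> e \<inter> ends \<Gamma> f \<noteq> {}" for s t e f
    using that edge_component_eq[of _ H] unfolding S_def by blast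
  have cyc: "cycle \<Gamma> s" if "s \<in> S" for s
    using that edge_component_cycle[OF fin Hc] by (auto simp: S_def)
  have even: "even_cycle \<Gamma> s" if s: "s \<in> S" for s
  proof (rule ccontr)
    assume "\<not> even_cycle \<Gamma> s"
    then have o: "odd_cycle \<Gamma> s" using cyc[OF s] by (simp add: even_cycle_def odd_cycle_def)
    have "0 < l e" if "e \<in> s" for e using HE(2) sH[OF s] that by blast
    then have "s \<in> odd_cycles_of \<Gamma> l"
      using odd_cycle_half[OF fin l o] o by (simp add: odd_cycles_of_def)
    then show False using odd by blast
  qed
  have "\<forall>s\<in>S. \<exists>M. M \<subseteq> s \<and> alternating \<Gamma> s M" using even_cycle_alternating[OF even] by metis
  then obtain M where M: "\<And>s. s \<in> S \<Longrightarrow> M s \<subseteq> s \<and> alternating \<Gamma> s (M s)" by metis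
  define A where "A = {e \<in> edges \<Gamma>. l e = 1} \<union> \<Union>(M ` S)"
  have AE: "A \<subseteq> edges \<Gamma>" using M sH HE(1) by (fastforce simp: A_def)
  have ends_ne: "ends \<Gamma> e \<noteq> {}" if "e \<in> H" for e using finite_mgraphD(4)[OF fin HE(1)[OF that]] .
  have AM: "e \<in> A \<longleftrightarrow> e \<in> M s" if s: "s \<in> S" and e: "e \<in> s" for s e
  proof -
    have eH: "e \<in> H" using sH s e by blast
    have "t = s" if "t \<in> S" "e \<in> M t" for t
      using same[OF that(1) s _ e, of e] M[OF that(1)] that(2) ends_ne[OF eH] by blast
    then show ?thesis using HE(3)[OF eH] s by (auto simp: A_def)
  qed
  have altA: "alternating \<Gamma> s A" if "s \<in> S" for s
    using M[OF that] AM[OF that] by (simp add: alternating_def)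
  have Anz: "l e \<noteq> 0" if "e \<in> A" for e
    using that M sH HE(2) by (fastforce simp: A_def)
  have pair: "l e + l f = 1" if "e \<in> H" "f \<in> H" "e \<noteq> f" "ends \<Gamma> e \<inter> ends \<Gamma> f \<noteq> {}" for e f
    using dimer_labeling_pair[OF fin l] that HE by blast
  have "\<forall>s\<in>S. \<exists>r. \<forall>e\<in>s. l e = (if e \<in> A then 1 - r else r)"
  proof
    fix s assume s: "s \<in> S"
    obtain e0 where e0: "e0 \<in> s" using cycle_nonempty[OF cyc[OF s]] by blast
    define r where "r = (if e0 \<in> A then 1 - l e0 else l e0)"
    have circ: "forms_circle \<Gamma> s" using cyc[OF s] by (simp add: cycle_def)
    have base: "l e0 = (if e0 \<in> A then 1 - r else r)" by (simp add: r_def)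
    have "l e = (if e \<in> A then 1 - r else r)" if e: "e \<in> s" for e
      using circ e0 base _ e
    proof (rule circle_induct)
      fix g h assume g: "g \<in> s" "h \<in> s" "l g = (if g \<in> A then 1 - r else r)" "ends \<Gamma> g \<inter> ends \<Gamma> h \<noteq> {}"
      show "l h = (if h \<in> A then 1 - r else r)"
      proof (cases "g = h")
        case False
        then have "l g + l h = 1" using pair[OF _ _ False g(4)] g(1,2) sH[OF s] by blast
        moreover have "g \<in> A \<longleftrightarrow> h \<notin> A" using altA[OF s] g False unfolding alternating_def by blast
        ultimately show ?thesis using g(3) by (auto split: if_splits)
      qed (use g in simp)
    qed
    then show "\<exists>r. \<forall>e\<in>s. l e = (if e \<in> A then 1 - r else r)" by blast
  qed
  then obtain r where r: "\<And>s e. \<lbrakk>s \<in> S; e \<in> s\<rbrakk> \<Longrightarrow> l e = (if e \<in> A then 1 - r s else r s)" by metis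
  define x where "x = restrict r S"
  have x: "x \<in> S \<rightarrow>\<^sub>E {0..1}"
  proof -
    have "r s \<in> {0..1}" if s: "s \<in> S" for s
    proof -
      obtain e where e: "e \<in> s" using cycle_nonempty[OF cyc[OF s]] by blast
      then have "0 < l e" "l e < 1" using HE sH[OF s] by auto
      then show ?thesis using r[OF s e] by (auto split: if_splits)
    qed
    then show ?thesis by (auto simp: x_def)
  qed
  have based: "(A, S) \<in> based_cubes \<Gamma>"
    unfolding based_cubes_def pairwise_def independent_edges_def
    using AE finS even same by (simp add: power_group_def) blast
  have "A \<in> dimer_coverings \<Gamma>"
    unfolding dimer_coverings_iff[OF fin]
  proof (intro conjI AE ballI)
    fix v assume v: "v \<in> verts \<Gamma>"
    have "splits_one l (incident \<Gamma> v (edges \<Gamma>))" using l v dimer_labelings_iff[OF fin] by blast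
    then show "\<exists>a. incident \<Gamma> v A = {a}"
      unfolding splits_one_def
    proof (elim disjE bexE conjE)
      fix a assume a: "a \<in> incident \<Gamma> v (edges \<Gamma>)" "l a = 1" "\<forall>g\<in>incident \<Gamma> v (edges \<Gamma>) - {a}. l g = 0"
      have "g \<in> A \<longleftrightarrow> g = a" if g: "v \<in> ends \<Gamma> g" for g
      proof
        assume "g \<in> A"
        then show "g = a" using Anz[of g] a(3) AE g by (auto simp: incident_def)
      qed (use a in \<open>auto simp: A_def incident_def\<close>)
      then show ?thesis using incident_eq_singleton[of v \<Gamma> A a] a(1) by (auto simp: incident_def)
    next
      fix a b assume ab: "a \<in> incident \<Gamma> v (edges \<Gamma>)" "b \<in> incident \<Gamma> v (edges \<Gamma>)" "a \<noteq> b"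
        "0 < l a" "0 < l b" "l a + l b = 1" "\<forall>g\<in>incident \<Gamma> v (edges \<Gamma>) - {a, b}. l g = 0"
      have va: "v \<in> ends \<Gamma> a" "v \<in> ends \<Gamma> b" using ab by (auto simp: incident_def)
      have H: "a \<in> H" "b \<in> H" using ab by (auto simp: H_def fractional_edges_def incident_def)
      then obtain s t where s: "s \<in> S" "a \<in> s" and t: "t \<in> S" "b \<in> t" using US by blast
      have "s = t" using same[OF s(1) t(1) s(2) t(2)] va by blast
      then have alt: "a \<in> A \<longleftrightarrow> b \<notin> A"
        using altA[OF s(1)] s t va ab(3) unfolding alternating_def by blast
      have "g \<in> A \<longleftrightarrow> g = (if a \<in> A then a else b)" if g: "v \<in> ends \<Gamma> g" for g
      proof
        assume gA: "g \<in> A"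
        then have "g = a \<or> g = b" using Anz[of g] ab(7) AE g by (auto simp: incident_def)
        then show "g = (if a \<in> A then a else b)" using gA alt by auto
      qed (use alt in \<open>auto split: if_splits\<close>)
      then have "incident \<Gamma> v A = {if a \<in> A then a else b}"
        by (rule incident_eq_singleton) (use va in auto)
      then show ?thesis by blast
    qed
  qed
  then have "(A, S) \<in> dimer_cubes \<Gamma>" using based altA dimer_cubes_iff[OF fin] by blast
  moreover have "cube_labeling \<Gamma> ((A, S), x) = l"
  proof (rule extensionalityI[OF cube_labeling_extensional])
    show "l \<in> extensional (edges \<Gamma>)" using l dimer_labelings_iff[OF fin] by blast
    fix e assume e: "e \<in> edges \<Gamma>"
    show "cube_labeling \<Gamma> ((A, S), x) e = l e"
    proof (cases "e \<in> \<Union>S")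
      case True
      then obtain s where s: "s \<in> S" "e \<in> s" by blast
      then show ?thesis
        using e r[OF s] cube_weight_inside[OF fin based s, of x] by (simp add: cube_labeling_apply x_def)
    next
      case False
      then have "\<not> (0 < l e \<and> l e < 1)" using US e by (simp add: H_def fractional_edges_def)
      then have "l e = 0 \<or> l e = 1" using dimer_labeling_range[OF fin l e] by linarith
      moreover have "e \<in> A \<longleftrightarrow> l e = 1" using False M e by (auto simp: A_def)
      ultimately show ?thesis using e False by (auto simp: cube_labeling_apply cube_weight_outside)
    qed
  qed
  ultimately show ?thesis using that x by blast
qed

text \<open>Shrinking all coordinates of a cube linearly to \<open>0\<close> ends at the base vertex.\<close>

lemma cube_labeling_path:
  assumes c: "(A, S) \<in> dimer_cubes \<Gamma>" and x: "x \<in> S \<rightarrow>\<^sub>E {0..1}"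
  shows "path_component_of (labeling_space \<Gamma>) (char_labeling \<Gamma> A) (cube_labeling \<Gamma> ((A, S), x))"
proof -
  define g where "g = (\<lambda>t::real. cube_labeling \<Gamma> ((A, S), \<lambda>s. t * x s))"
  have w: "cube_weight S (\<lambda>s. t * x s) e = t * cube_weight S x e" for t e
    by (simp add: cube_weight_def sum_distrib_left)
  have mem: "g t \<in> dimer_labelings \<Gamma>" if t: "t \<in> {0..1}" for t
    unfolding g_def
  proof (rule cube_labeling_in[OF fin c])
    fix s assume "s \<in> S"
    then have "0 \<le> x s" "x s \<le> 1" using x by auto
    then show "0 \<le> t * x s \<and> t * x s \<le> 1" using t by (auto intro: mult_le_one)
  qed
  have "continuous_map (top_of_set {0..1})
      (product_topology (\<lambda>_. top_of_set {0..1::real}) (edges \<Gamma>)) g"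
    unfolding continuous_map_componentwise
  proof (intro conjI ballI)
    show "g ` topspace (top_of_set {0..1}) \<subseteq> extensional (edges \<Gamma>)"
      by (auto simp: g_def cube_labeling_def)
    fix e assume e: "e \<in> edges \<Gamma>"
    have "continuous_on {0..1} (\<lambda>t. g t e)"
      by (cases "e \<in> A") (use e in \<open>auto simp: g_def cube_labeling_apply w intro!: continuous_intros\<close>)
    moreover have "g t e \<in> {0..1}" if "t \<in> {0..1}" for t
      using dimer_labeling_range[OF fin mem[OF that] e] by simp
    ultimately show "continuous_map (top_of_set {0..1}) (top_of_set {0..1}) (\<lambda>t. g t e)"
      by auto
  qed
  then have "pathin (labeling_space \<Gamma>) g"
    using mem by (auto simp: pathin_def labeling_space_def continuous_map_in_subtopology)
  moreover have "g 0 = char_labeling \<Gamma> A"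
    by (rule ext) (simp add: g_def cube_labeling_def char_labeling_def cube_weight_def indicator_def)
  moreover have "g 1 = cube_labeling \<Gamma> ((A, S), x)" by (simp add: g_def)
  ultimately show ?thesis unfolding path_component_of_def by blast
qed

lemma odd_cycles_of_char: "odd_cycles_of \<Gamma> (char_labeling \<Gamma> A) = {}"
proof -
  have False if c: "c \<in> odd_cycles_of \<Gamma> (char_labeling \<Gamma> A)" for c
  proof -
    have "cycle \<Gamma> c" using c by (simp add: odd_cycles_of_def odd_cycle_def)
    then obtain e where "e \<in> c" "e \<in> edges \<Gamma>" using cycle_nonempty cycle_subset by blast
    moreover from this have "char_labeling \<Gamma> A e = 1/2" using c by (auto simp: odd_cycles_of_def)
    ultimately show False by (cases "e \<in> A") (simp_all add: char_labeling_def)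
  qed
  then show ?thesis by blast
qed

text \<open>A labeling obtained from a cube is joined by a path to the characteristic labeling of a dimer covering,
  which has no label \<open>1/2\<close>; the invariance of the set of odd cycles along paths gives one inclusion.\<close>

lemma cube_labeling_image:
  "cube_labeling \<Gamma> ` {p \<in> topspace (cube_sum \<Gamma>). fst p \<in> dimer_cubes \<Gamma>} =
     {l \<in> dimer_labelings \<Gamma>. odd_cycles_of \<Gamma> l = {}}"
proof (intro subset_antisym subsetI)
  fix l assume "l \<in> cube_labeling \<Gamma> ` {p \<in> topspace (cube_sum \<Gamma>). fst p \<in> dimer_cubes \<Gamma>}"
  then obtain A S x where p: "l = cube_labeling \<Gamma> ((A, S), x)" "(A, S) \<in> dimer_cubes \<Gamma>"
    "((A, S), x) \<in> topspace (cube_sum \<Gamma>)" by auto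
  then have x: "x \<in> S \<rightarrow>\<^sub>E {0..1}" by (simp add: mem_cube_sum)
  have "path_component_of (labeling_space \<Gamma>) (char_labeling \<Gamma> A) l"
    using cube_labeling_path[OF p(2) x] p(1) by simp
  then have "odd_cycles_of \<Gamma> l = {}"
    using path_component_odd_cycles_of[OF fin] odd_cycles_of_char by blast
  moreover have "l \<in> dimer_labelings \<Gamma>"
    unfolding p(1) by (rule cube_labeling_in[OF fin p(2)]) (use x in auto)
  ultimately show "l \<in> {l \<in> dimer_labelings \<Gamma>. odd_cycles_of \<Gamma> l = {}}" by blast
next
  fix l assume "l \<in> {l \<in> dimer_labelings \<Gamma>. odd_cycles_of \<Gamma> l = {}}"
  then have "l \<in> dimer_labelings \<Gamma>" "odd_cycles_of \<Gamma> l = {}" by simp_all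
  then obtain A S x where p: "(A, S) \<in> dimer_cubes \<Gamma>" "x \<in> S \<rightarrow>\<^sub>E {0..1}" "cube_labeling \<Gamma> ((A, S), x) = l"
    by (rule cube_labeling_surj)
  then have "((A, S), x) \<in> {p \<in> topspace (cube_sum \<Gamma>). fst p \<in> dimer_cubes \<Gamma>}"
    by (simp add: mem_cube_sum dimer_cubes_def)
  then show "l \<in> cube_labeling \<Gamma> ` {p \<in> topspace (cube_sum \<Gamma>). fst p \<in> dimer_cubes \<Gamma>}"
    using p(3) by blast
qed

lemma labeling_space0_eq: "labeling_space0 \<Gamma> = {l \<in> dimer_labelings \<Gamma>. odd_cycles_of \<Gamma> l = {}}"
    (is "_ = ?G")
proof (cases "dimer_coverings \<Gamma> = {}")
  case True
  have "?G = {}"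
  proof (rule ccontr)
    assume "?G \<noteq> {}"
    then obtain l where "l \<in> dimer_labelings \<Gamma>" "odd_cycles_of \<Gamma> l = {}" by blast
    then obtain A S where "(A, S) \<in> dimer_cubes \<Gamma>" by (rule cube_labeling_surj)
    then show False using True dimer_cubes_iff[OF fin] by blast
  qed
  then show ?thesis using True by (simp add: labeling_space0_def)
next
  case False
  let ?X = "labeling_space \<Gamma>"
  obtain D where D: "D \<in> dimer_coverings \<Gamma>" using False by blast
  have refl: "path_component_of ?X (char_labeling \<Gamma> D) (char_labeling \<Gamma> D')" if "D' \<in> dimer_coverings \<Gamma>" for D'
    using path_component_char_labeling[OF fin D that] .
  have top: "char_labeling \<Gamma> D \<in> topspace ?X"
    using refl[OF D] path_component_of_equiv[of ?X] by blast
  have G: "?G = Collect (path_component_of ?X (char_labeling \<Gamma> D))"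
  proof (intro subset_antisym subsetI)
    fix l assume "l \<in> ?G"
    then have "l \<in> dimer_labelings \<Gamma>" "odd_cycles_of \<Gamma> l = {}" by simp_all
    then obtain A S x where p: "(A, S) \<in> dimer_cubes \<Gamma>" "x \<in> S \<rightarrow>\<^sub>E {0..1}" "cube_labeling \<Gamma> ((A, S), x) = l"
      by (rule cube_labeling_surj)
    then have "A \<in> dimer_coverings \<Gamma>" using dimer_cubes_iff[OF fin] by blast
    then show "l \<in> Collect (path_component_of ?X (char_labeling \<Gamma> D))"
      using path_component_of_trans[OF refl] cube_labeling_path[OF p(1,2)] p(3) by blast
  next
    fix l assume l: "l \<in> Collect (path_component_of ?X (char_labeling \<Gamma> D))"
    then have "l \<in> topspace ?X" using path_component_of_equiv[of ?X _ l] by blast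
    then show "l \<in> ?G"
      using l path_component_odd_cycles_of[OF fin] odd_cycles_of_char topspace_labeling_space[OF fin] by blast
  qed
  have "?G \<in> path_components_of ?X"
    unfolding G using top by (simp add: path_component_in_path_components_of)
  moreover have "\<forall>D\<in>dimer_coverings \<Gamma>. char_labeling \<Gamma> D \<in> ?G" unfolding G using refl by blast
  ultimately have "(THE C. C \<in> path_components_of ?X \<and> (\<forall>D\<in>dimer_coverings \<Gamma>. char_labeling \<Gamma> D \<in> C)) = ?G"
    by (intro the1_equality[OF labeling_space0_unique[OF fin False]]) blast
  then show ?thesis using False by (simp add: labeling_space0_def)
qed

lemma cube_weight_cases:
  assumes "(A, S) \<in> based_cubes \<Gamma>"
  obtains s where "s \<in> S" "\<And>x. cube_weight S x e = x s" | "\<And>x. cube_weight S x e = 0"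
  using cube_weight_inside[OF fin assms, of _ e] cube_weight_outside[of e S] by (metis UnionE)

lemma continuous_map_cube_labeling:
  "continuous_map (cube_sum \<Gamma>) (product_topology (\<lambda>_. top_of_set {0..1}) (edges \<Gamma>)) (cube_labeling \<Gamma>)"
  unfolding cube_sum_def
proof (rule continuous_map_from_sum_topology)
  fix c assume c: "c \<in> based_cubes \<Gamma>"
  obtain A S where AS: "c = (A, S)" by (cases c)
  let ?P = "product_topology (\<lambda>_. top_of_set {0..1::real}) S"
  have b: "(A, S) \<in> based_cubes \<Gamma>" using c AS by simp
  have "continuous_map ?P (product_topology (\<lambda>_. top_of_set {0..1}) (edges \<Gamma>))
      (\<lambda>x. cube_labeling \<Gamma> ((A, S), x))"
    unfolding continuous_map_componentwise
  proof (intro conjI ballI)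
    show "(\<lambda>x. cube_labeling \<Gamma> ((A, S), x)) ` topspace ?P \<subseteq> extensional (edges \<Gamma>)"
      using cube_labeling_extensional by blast
    fix e assume e: "e \<in> edges \<Gamma>"
    have w: "continuous_map ?P euclideanreal (\<lambda>x. cube_weight S x e) \<and>
        (\<forall>x\<in>topspace ?P. cube_weight S x e \<in> {0..1})"
    proof (cases rule: cube_weight_cases[OF b, of e])
      case (1 s)
      then show ?thesis
        using continuous_map_into_fulltopology[OF continuous_map_product_projection[OF 1(1)]] by auto
    qed simp
    then have "continuous_map ?P euclideanreal (\<lambda>x. cube_labeling \<Gamma> ((A, S), x) e)"
      using e by (auto simp: cube_labeling_apply intro!: continuous_map_diff)
    then show "continuous_map ?P (top_of_set {0..1}) (\<lambda>x. cube_labeling \<Gamma> ((A, S), x) e)"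
      using w e by (auto simp: continuous_map_in_subtopology cube_labeling_apply)
  qed
  then show "continuous_map (case c of (A, S) \<Rightarrow> product_topology (\<lambda>_. top_of_set {0..1}) S)
      (product_topology (\<lambda>_. top_of_set {0..1}) (edges \<Gamma>)) (\<lambda>x. cube_labeling \<Gamma> (c, x))"
    by (simp add: AS)
qed

lemma finite_based_cubes: "finite (based_cubes \<Gamma>)"
proof (rule finite_subset)
  show "based_cubes \<Gamma> \<subseteq> Pow (edges \<Gamma>) \<times> Pow (Pow (edges \<Gamma>))"
  proof
    fix c assume c: "c \<in> based_cubes \<Gamma>"
    obtain A S where AS: "c = (A, S)" by (cases c)
    show "c \<in> Pow (edges \<Gamma>) \<times> Pow (Pow (edges \<Gamma>))"
      using based_cubesD(1,4)[OF fin, of A S] c unfolding AS by auto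
  qed
  show "finite (Pow (edges \<Gamma>) \<times> Pow (Pow (edges \<Gamma>)))" using finite_mgraphD(1)[OF fin] by simp
qed

lemma compact_dimer_cube_points:
  "compactin (cube_sum \<Gamma>) {p \<in> topspace (cube_sum \<Gamma>). fst p \<in> dimer_cubes \<Gamma>}" (is "compactin _ ?Q")
proof -
  let ?X = "\<lambda>(A, S). product_topology (\<lambda>_. top_of_set {0..1::real}) S"
  have "compactin (cube_sum \<Gamma>) (Pair c ` topspace (?X c))" if c: "c \<in> based_cubes \<Gamma>" for c
    unfolding cube_sum_def
  proof (rule image_compactin)
    have "compact_space (?X c)"
      by (cases c) (simp add: compact_space_product_topology compact_space_subtopology)
    then show "compactin (?X c) (topspace (?X c))" unfolding compact_space_def .
    show "continuous_map (?X c) (sum_topology ?X (based_cubes \<Gamma>)) (Pair c)"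
      using continuous_map_component_injection[OF c, of ?X] by simp
  qed
  then have "compactin (cube_sum \<Gamma>) (\<Union>c\<in>dimer_cubes \<Gamma>. Pair c ` topspace (?X c))"
    by (intro compactin_Union) (use finite_subset[OF _ finite_based_cubes] in \<open>auto simp: dimer_cubes_def\<close>)
  moreover have "(\<Union>c\<in>dimer_cubes \<Gamma>. Pair c ` topspace (?X c)) = ?Q"
    by (auto simp: cube_sum_def dimer_cubes_def)
  ultimately show ?thesis by simp
qed

text \<open>The dimer complex is the image of finitely many compact cubes, hence compact.  A continuous bijection
  from it onto a Hausdorff space is a homeomorphism, and \<open>cube_labeling\<close> induces one.\<close>

lemma labeling_space0_homeomorphic_dimer_complex:
  "subtopology (labeling_space \<Gamma>) (labeling_space0 \<Gamma>) homeomorphic_space dimer_complex \<Gamma>"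
proof -
  let ?P = "product_topology (\<lambda>_. top_of_set {0..1::real}) (edges \<Gamma>)"
  let ?Q = "{p \<in> topspace (cube_sum \<Gamma>). fst p \<in> dimer_cubes \<Gamma>}"
  let ?Y = "subtopology (labeling_space \<Gamma>) (labeling_space0 \<Gamma>)"
  have q: "quotient_map (cube_sum \<Gamma>) (cubed_complex \<Gamma>) (cube_class \<Gamma>)"
    unfolding cubed_complex_def by (rule quotient_map_quotient_topology)
  obtain g where g: "continuous_map (cubed_complex \<Gamma>) ?P g"
    "\<And>p. p \<in> topspace (cube_sum \<Gamma>) \<Longrightarrow> g (cube_class \<Gamma> p) = cube_labeling \<Gamma> p"
  proof (rule quotient_map_lift_exists[OF q continuous_map_cube_labeling])
    fix p p' assume "cube_class \<Gamma> p = cube_class \<Gamma> p'"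
    then have "p' \<in> cube_class \<Gamma> p" by (simp add: cube_class_def)
    then show "cube_labeling \<Gamma> p = cube_labeling \<Gamma> p'"
      using cube_labeling_equiv[OF fin] by (simp add: cube_class_def)
  qed blast
  have K: "dimer_complex \<Gamma> = subtopology (cubed_complex \<Gamma>) (cube_class \<Gamma> ` ?Q)"
    unfolding dimer_complex_def
    by (rule arg_cong[where f = "subtopology _"]) (force simp: dimer_cubes_def cube_sum_def)
  have cK: "compactin (cubed_complex \<Gamma>) (cube_class \<Gamma> ` ?Q)"
    using image_compactin[OF compact_dimer_cube_points quotient_imp_continuous_map[OF q]] .
  have topK: "topspace (dimer_complex \<Gamma>) = cube_class \<Gamma> ` ?Q"
    using compactin_subset_topspace[OF cK] by (auto simp: K)
  have topY: "topspace ?Y = labeling_space0 \<Gamma>"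
    using topspace_labeling_space[OF fin] labeling_space0_eq by auto
  have img: "g ` topspace (dimer_complex \<Gamma>) = topspace ?Y"
  proof -
    have "g ` cube_class \<Gamma> ` ?Q = cube_labeling \<Gamma> ` ?Q"
      unfolding image_image by (rule image_cong) (use g(2) in auto)
    then show ?thesis using cube_labeling_image labeling_space0_eq topK topY by simp
  qed
  have "homeomorphic_map (dimer_complex \<Gamma>) ?Y g"
  proof (rule continuous_imp_homeomorphic_map)
    show "compact_space (dimer_complex \<Gamma>)" unfolding K using cK by (rule compact_space_subtopology)
    show "Hausdorff_space ?Y"
      unfolding labeling_space_def
      by (intro Hausdorff_space_subtopology) (simp add: Hausdorff_space_product_topology Hausdorff_space_subtopology)
    have "continuous_map (dimer_complex \<Gamma>) ?P g"
      unfolding K using g(1) by (rule continuous_map_from_subtopology)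
    moreover have "g ` topspace (dimer_complex \<Gamma>) \<subseteq> dimer_labelings \<Gamma> \<inter> labeling_space0 \<Gamma>"
      unfolding img topY using labeling_space0_eq by blast
    ultimately show "continuous_map (dimer_complex \<Gamma>) ?Y g"
      unfolding labeling_space_def subtopology_subtopology
      by (auto simp: continuous_map_in_subtopology)
    show "g ` topspace (dimer_complex \<Gamma>) = topspace ?Y" by (rule img)
    show "inj_on g (topspace (dimer_complex \<Gamma>))"
      unfolding topK
    proof (rule inj_onI, elim imageE)
      fix k k' p p' assume kp: "k = cube_class \<Gamma> p" "k' = cube_class \<Gamma> p'" and p: "p \<in> ?Q" "p' \<in> ?Q"
        and eq: "g k = g k'"
      obtain A S x B R y where AS: "p = ((A, S), x)" "p' = ((B, R), y)" by (metis surj_pair)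
      have "cube_labeling \<Gamma> p = cube_labeling \<Gamma> p'" using eq kp g(2) p by simp
      then have "equivclp (cube_glue \<Gamma>) p p'"
        using cube_labeling_inj[of A S x B R y] p AS by (simp add: mem_cube_sum)
      then show "k = k'"
        unfolding kp cube_class_def by (blast intro: equivclp_trans equivclp_sym)
    qed
  qed
  then show ?thesis
    using homeomorphic_map_imp_homeomorphic_space homeomorphic_space_sym by blast
qed

end

section \<open>The other components\<close>

text \<open>Edges with label \<open>0\<close> may be removed or added at a vertex.\<close>

lemma splits_one_restrict:
  assumes "J \<subseteq> I" "\<And>g. g \<in> I - J \<Longrightarrow> l g = 0" "\<And>g. g \<in> J \<Longrightarrow> l g = l' g"
  shows "splits_one l I \<longleftrightarrow> splits_one l' J"
proof
  assume "splits_one l I"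
  then show "splits_one l' J"
    unfolding splits_one_def[of l I]
  proof (elim disjE bexE conjE)
    fix a assume a: "a \<in> I" "l a = 1" "\<forall>g\<in>I - {a}. l g = 0"
    then have "a \<in> J" using assms(2)[of a] by force
    then show ?thesis using a assms by (intro splits_one_singleI[of a]) force+
  next
    fix a b assume ab: "a \<in> I" "b \<in> I" "a \<noteq> b" "0 < l a" "0 < l b" "l a + l b = 1"
      "\<forall>g\<in>I - {a, b}. l g = 0"
    then have "a \<in> J" "b \<in> J" using assms(2)[of a] assms(2)[of b] by force+
    then show ?thesis using ab assms by (intro splits_one_pairI[of a _ b]) force+
  qed
next
  assume "splits_one l' J"
  then show "splits_one l I"
    unfolding splits_one_def[of l' J]
  proof (elim disjE bexE conjE)
    fix a assume a: "a \<in> J" "l' a = 1" "\<forall>g\<in>J - {a}. l' g = 0"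
    show ?thesis
      by (rule splits_one_singleI[of a]) (use a assms in \<open>auto, metis Diff_iff singletonD\<close>)
  next
    fix a b assume ab: "a \<in> J" "b \<in> J" "a \<noteq> b" "0 < l' a" "0 < l' b" "l' a + l' b = 1"
      "\<forall>g\<in>J - {a, b}. l' g = 0"
    have "l g = 0" if "g \<in> I" "g \<noteq> a" "g \<noteq> b" for g
      using that ab(7) assms(2,3)[of g] by (cases "g \<in> J") auto
    then show ?thesis using ab assms by (intro splits_one_pairI[of a _ b]) auto
  qed
qed

text \<open>Labels on the edges that touch the given cycles are forced, so that only the rest of the graph carries
  information.\<close>

definition delete_cycles :: "('v, 'e) mgraph \<Rightarrow> 'e set set \<Rightarrow> ('v, 'e) mgraph" where
  "delete_cycles \<Gamma> Om =
     (let V = verts \<Gamma> - \<Union>(ends \<Gamma> ` \<Union>Om)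
      in \<lparr>verts = V, edges = {e \<in> edges \<Gamma>. ends \<Gamma> e \<subseteq> V}, ends = ends \<Gamma>\<rparr>)"

lemma delete_cycles_simps:
  "verts (delete_cycles \<Gamma> Om) = verts \<Gamma> - \<Union>(ends \<Gamma> ` \<Union>Om)"
  "e \<in> edges (delete_cycles \<Gamma> Om) \<longleftrightarrow> e \<in> edges \<Gamma> \<and> ends \<Gamma> e \<subseteq> verts (delete_cycles \<Gamma> Om)"
  "ends (delete_cycles \<Gamma> Om) = ends \<Gamma>"
  by (simp_all add: delete_cycles_def Let_def)

lemma incident_delete_cycles: "incident (delete_cycles \<Gamma> Om) v s = incident \<Gamma> v s"
  by (simp add: incident_def delete_cycles_simps)

lemma finite_mgraph_delete_cycles: "finite_mgraph \<Gamma> \<Longrightarrow> finite_mgraph (delete_cycles \<Gamma> Om)"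
  by (auto simp: finite_mgraph_def mgraph_def delete_cycles_simps intro: finite_subset[of _ "edges \<Gamma>"])

lemma subgraph_delete_cycles: "finite_mgraph \<Gamma> \<Longrightarrow> subgraph (delete_cycles \<Gamma> Om) \<Gamma>"
  using finite_mgraph_delete_cycles[of \<Gamma> Om]
  by (auto simp: subgraph_def finite_mgraph_def delete_cycles_simps)

lemma cycle_delete_cycles:
  assumes "c \<subseteq> edges (delete_cycles \<Gamma> Om)"
  shows "cycle (delete_cycles \<Gamma> Om) c \<longleftrightarrow> cycle \<Gamma> c"
proof -
  have "ends \<Gamma> e \<subseteq> verts (delete_cycles \<Gamma> Om)" if "e \<in> c" for e
    using assms that delete_cycles_simps(2)[of e \<Gamma> Om] by blast
  then have "incident \<Gamma> v c = {}" if "v \<in> verts \<Gamma> - verts (delete_cycles \<Gamma> Om)" for v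
    using that by (auto simp: incident_def)
  moreover have "verts (delete_cycles \<Gamma> Om) \<subseteq> verts \<Gamma>" "edges (delete_cycles \<Gamma> Om) \<subseteq> edges \<Gamma>"
    by (auto simp: delete_cycles_simps)
  ultimately have "cyclic_set (delete_cycles \<Gamma> Om) c \<longleftrightarrow> cyclic_set \<Gamma> c"
    using assms unfolding cyclic_set_def incident_delete_cycles by blast
  then show ?thesis by (simp add: cycle_def forms_circle_def delete_cycles_simps)
qed

context
  fixes \<Gamma> :: "('v, 'e) mgraph"
  assumes fin: "finite_mgraph \<Gamma>"
begin

text \<open>An edge that meets an odd cycle of \<open>l\<close> without belonging to it ends at a vertex where two labels \<open>1/2\<close> are
  present already.\<close>

lemma odd_cycle_labeling_forced:
  assumes l: "l \<in> dimer_labelings \<Gamma>"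
    and e: "e \<in> edges \<Gamma>" "e \<notin> edges (delete_cycles \<Gamma> (odd_cycles_of \<Gamma> l))"
  shows "l e = (if e \<in> \<Union>(odd_cycles_of \<Gamma> l) then 1/2 else 0)"
proof (cases "e \<in> \<Union>(odd_cycles_of \<Gamma> l)")
  case True
  then show ?thesis by (auto simp: odd_cycles_of_def)
next
  case False
  have "ends \<Gamma> e \<subseteq> verts \<Gamma>" using finite_mgraphD(3)[OF fin e(1)] .
  then obtain v f c where v: "v \<in> ends \<Gamma> e" "v \<in> ends \<Gamma> f" "f \<in> c" "c \<in> odd_cycles_of \<Gamma> l"
    using e by (auto simp: delete_cycles_simps)
  then have c: "cycle \<Gamma> c" "\<And>g. g \<in> c \<Longrightarrow> l g = 1/2"
    by (auto simp: odd_cycles_of_def odd_cycle_def)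
  obtain h where h: "h \<in> c" "h \<noteq> f" "v \<in> ends \<Gamma> h" using cycle_incident[OF fin c(1) v(3,2)] by metis
  have "f \<in> edges \<Gamma>" "h \<in> edges \<Gamma>" using v(3) h(1) cycle_subset[OF c(1)] by auto
  then have I: "f \<in> incident \<Gamma> v (edges \<Gamma>)" "h \<in> incident \<Gamma> v (edges \<Gamma>)"
    using v h by (simp_all add: incident_def)
  have "\<forall>g\<in>incident \<Gamma> v (edges \<Gamma>) - {f, h}. l g = 0"
    using splits_one_pair[OF dimer_labeling_splits(1)[OF fin l e(1) v(1)] I h(2)[symmetric]] c(2) v(3) h(1)
    by simp
  moreover have "e \<noteq> f" "e \<noteq> h" using False v h by auto
  ultimately show ?thesis using False e v by (simp add: incident_def)
qed

text \<open>Labelings with the same odd cycles agree on all edges that touch these cycles, so they are determined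
  by their restrictions to the remaining graph.  These restrictions have no odd cycles.  Conversely a
  labeling of the remaining graph without odd cycles extends by the values of \<open>l0\<close>; the extension acquires no
  new odd cycle, since \<open>l0\<close> vanishes on the edges between the remaining graph and the deleted vertices.\<close>

lemma odd_cycle_component_homeomorphic:
  assumes l0: "l0 \<in> dimer_labelings \<Gamma>" and Om: "Om = odd_cycles_of \<Gamma> l0"
  shows "subtopology (labeling_space \<Gamma>) {l \<in> dimer_labelings \<Gamma>. odd_cycles_of \<Gamma> l = Om}
    homeomorphic_space
    subtopology (labeling_space (delete_cycles \<Gamma> Om)) (labeling_space0 (delete_cycles \<Gamma> Om))"
proof -
  define \<Gamma>' where "\<Gamma>' = delete_cycles \<Gamma> Om"
  define G where "G = {l \<in> dimer_labelings \<Gamma>. odd_cycles_of \<Gamma> l = Om}"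
  define G' where "G' = {l \<in> dimer_labelings \<Gamma>'. odd_cycles_of \<Gamma>' l = {}}"
  \<comment> \<open>restriction to the subgraph, and extension by the values of \<open>l0\<close>\<close>
  define r where "r = (\<lambda>l::'e \<Rightarrow> real. restrict l (edges \<Gamma>'))"
  define q where "q = (\<lambda>l. \<lambda>e\<in>edges \<Gamma>. if e \<in> edges \<Gamma>' then l e else l0 e)"
  have fin': "finite_mgraph \<Gamma>'" using finite_mgraph_delete_cycles[OF fin] by (simp add: \<Gamma>'_def)
  have EE: "edges \<Gamma>' \<subseteq> edges \<Gamma>" by (auto simp: \<Gamma>'_def delete_cycles_simps)
  have VV: "verts \<Gamma>' \<subseteq> verts \<Gamma>" by (auto simp: \<Gamma>'_def delete_cycles_simps)
  have inc: "incident \<Gamma>' v s = incident \<Gamma> v s" for v s by (simp add: \<Gamma>'_def incident_delete_cycles)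
  have cyc: "odd_cycle \<Gamma>' c \<longleftrightarrow> odd_cycle \<Gamma> c" if "c \<subseteq> edges \<Gamma>'" for c
    using cycle_delete_cycles[of c \<Gamma> Om] that by (simp add: \<Gamma>'_def odd_cycle_def)
  have notOm: "e \<notin> \<Union>Om" if "e \<in> edges \<Gamma>'" for e
    using that finite_mgraphD(4)[OF fin, of e] by (auto simp: \<Gamma>'_def delete_cycles_simps)
  have forced: "l e = (if e \<in> \<Union>Om then 1/2 else 0)" if "l \<in> G" "e \<in> edges \<Gamma>" "e \<notin> edges \<Gamma>'" for l e
    using odd_cycle_labeling_forced[of l e] that by (auto simp: G_def \<Gamma>'_def)
  have l0G: "l0 \<in> G" using l0 Om by (simp add: G_def)
  have zero: "l g = 0" if "l \<in> G" "v \<in> verts \<Gamma>'" "g \<in> edges \<Gamma>" "g \<notin> edges \<Gamma>'" "v \<in> ends \<Gamma> g" for l v g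
    using forced[of l g] that by (auto simp: \<Gamma>'_def delete_cycles_simps)
  have isub: "incident \<Gamma> v (edges \<Gamma>') \<subseteq> incident \<Gamma> v (edges \<Gamma>)" for v
    using EE by (auto simp: incident_def)
  have G_labels: "l \<in> dimer_labelings \<Gamma>" if "l \<in> G" for l using that by (simp add: G_def)
  have G'_labels: "l \<in> dimer_labelings \<Gamma>'" if "l \<in> G'" for l using that by (simp add: G'_def)
  have rG: "r l \<in> G'" if l: "l \<in> G" for l
  proof -
    have "splits_one (r l) (incident \<Gamma> v (edges \<Gamma>'))" if v: "v \<in> verts \<Gamma>'" for v
    proof -
      have "splits_one l (incident \<Gamma> v (edges \<Gamma>))"
        using G_labels[OF l] dimer_labelings_iff[OF fin] v VV by blast
      then show ?thesis
        using splits_one_restrict[OF isub, where l = l and l' = "r l"] zero[OF l v]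
        by (auto simp: incident_def r_def)
    qed
    then have "r l \<in> dimer_labelings \<Gamma>'"
      unfolding dimer_labelings_iff[OF fin'] by (auto simp: inc r_def)
    moreover have "odd_cycles_of \<Gamma>' (r l) = {}"
    proof -
      have False if c: "odd_cycle \<Gamma>' c" and half: "\<forall>e\<in>c. r l e = 1/2" for c
      proof -
        have sub: "c \<subseteq> edges \<Gamma>'" and ne: "c \<noteq> {}"
          using c cycle_subset cycle_nonempty by (auto simp: odd_cycle_def)
        have "r l e = l e" if "e \<in> c" for e using sub that by (auto simp: r_def)
        then have "\<forall>e\<in>c. l e = 1/2" using half by simp
        then have "c \<in> odd_cycles_of \<Gamma> l" using c cyc[OF sub] by (simp add: odd_cycles_of_def)
        then have "c \<in> Om" using l by (simp add: G_def)
        then show False using ne sub notOm by blast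
      qed
      then show ?thesis by (auto simp: odd_cycles_of_def)
    qed
    ultimately show ?thesis by (simp add: G'_def)
  qed
  have qG: "q l \<in> G" if l: "l \<in> G'" for l
  proof -
    have "splits_one (q l) (incident \<Gamma> v (edges \<Gamma>))" if v: "v \<in> verts \<Gamma>" for v
    proof (cases "v \<in> verts \<Gamma>'")
      case True
      have "splits_one l (incident \<Gamma> v (edges \<Gamma>'))"
        using G'_labels[OF l] dimer_labelings_iff[OF fin'] True by (simp add: inc)
      moreover have "q l g = 0" if "g \<in> incident \<Gamma> v (edges \<Gamma>) - incident \<Gamma> v (edges \<Gamma>')" for g
        using that zero[OF l0G True, of g] by (auto simp: incident_def q_def)
      moreover have "q l g = l g" if "g \<in> incident \<Gamma> v (edges \<Gamma>')" for g
        using that EE by (auto simp: incident_def q_def)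
      ultimately show ?thesis using splits_one_restrict[OF isub, where l = "q l" and l' = l] by blast
    next
      case False
      have "splits_one l0 (incident \<Gamma> v (edges \<Gamma>))" using l0 v dimer_labelings_iff[OF fin] by blast
      moreover have "q l g = l0 g" if "g \<in> incident \<Gamma> v (edges \<Gamma>)" for g
        using that False by (auto simp: incident_def q_def \<Gamma>'_def delete_cycles_simps)
      ultimately show ?thesis
        using splits_one_restrict[OF subset_refl, where l = "q l" and l' = l0] by simp
    qed
    then have "q l \<in> dimer_labelings \<Gamma>"
      unfolding dimer_labelings_iff[OF fin] by (auto simp: q_def)
    moreover have "c \<in> odd_cycles_of \<Gamma> (q l) \<longleftrightarrow> c \<in> Om" for c
    proof
      assume c: "c \<in> Om"
      then have "odd_cycle \<Gamma> c" "\<forall>e\<in>c. l0 e = 1/2" using Om by (auto simp: odd_cycles_of_def)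
      moreover from this have "c \<subseteq> edges \<Gamma>" using cycle_subset by (auto simp: odd_cycle_def)
      moreover have "e \<notin> edges \<Gamma>'" if "e \<in> c" for e using notOm[of e] c that by blast
      ultimately show "c \<in> odd_cycles_of \<Gamma> (q l)" by (auto simp: odd_cycles_of_def q_def)
    next
      assume "c \<in> odd_cycles_of \<Gamma> (q l)"
      then have c: "odd_cycle \<Gamma> c" "\<And>e. e \<in> c \<Longrightarrow> q l e = 1/2" by (auto simp: odd_cycles_of_def)
      have cE: "c \<subseteq> edges \<Gamma>" using c(1) cycle_subset by (auto simp: odd_cycle_def)
      have circ: "forms_circle \<Gamma> c" using c(1) by (simp add: odd_cycle_def cycle_def)
      have none: "c \<inter> edges \<Gamma>' = {}"
      proof (rule ccontr)
        assume "c \<inter> edges \<Gamma>' \<noteq> {}"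
        then obtain e0 where e0: "e0 \<in> c" "e0 \<in> edges \<Gamma>'" by blast
        have sub: "c \<subseteq> edges \<Gamma>'"
        proof
          fix f assume f: "f \<in> c"
          show "f \<in> edges \<Gamma>'"
            using circ e0(1) e0(2) _ f
          proof (rule circle_induct)
            fix g h assume gh: "g \<in> c" "h \<in> c" "g \<in> edges \<Gamma>'" "ends \<Gamma> g \<inter> ends \<Gamma> h \<noteq> {}"
            then obtain v where v: "v \<in> ends \<Gamma> g" "v \<in> ends \<Gamma> h" by blast
            then have v': "v \<in> verts \<Gamma>'" using gh(3) by (auto simp: \<Gamma>'_def delete_cycles_simps)
            have h: "h \<in> edges \<Gamma>" using cE gh(2) by blast
            show "h \<in> edges \<Gamma>'"
            proof (rule ccontr)
              assume n: "h \<notin> edges \<Gamma>'"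
              then show False using zero[OF l0G v' h n v(2)] c(2)[OF gh(2)] h by (simp add: q_def)
            qed
          qed
        qed
        have "\<forall>e\<in>c. l e = 1/2" using c(2) sub EE by (force simp: q_def)
        then have "c \<in> odd_cycles_of \<Gamma>' l" using c(1) cyc[OF sub] by (simp add: odd_cycles_of_def)
        then show False using l by (simp add: G'_def)
      qed
      have "l0 e = 1/2" if "e \<in> c" for e
        using c(2)[OF that] none that cE by (auto simp: q_def split: if_splits)
      then show "c \<in> Om" unfolding Om using c(1) by (simp add: odd_cycles_of_def)
    qed
    ultimately show ?thesis by (auto simp: G_def)
  qed
  have qr: "q (r l) = l" if l: "l \<in> G" for l
  proof (rule extensionalityI[of _ "edges \<Gamma>"])
    show "l \<in> extensional (edges \<Gamma>)" using G_labels[OF l] dimer_labelings_iff[OF fin] by blast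
    fix e assume "e \<in> edges \<Gamma>"
    then show "q (r l) e = l e" using forced[OF l, of e] forced[OF l0G, of e] by (simp add: q_def r_def)
  qed (simp add: q_def)
  have rq: "r (q l) = l" if l: "l \<in> G'" for l
  proof (rule extensionalityI[of _ "edges \<Gamma>'"])
    show "l \<in> extensional (edges \<Gamma>')" using G'_labels[OF l] dimer_labelings_iff[OF fin'] by blast
    fix e assume "e \<in> edges \<Gamma>'"
    then show "r (q l) e = l e" using EE by (auto simp: q_def r_def)
  qed (simp add: r_def)
  let ?X = "subtopology (labeling_space \<Gamma>) G" and ?X' = "subtopology (labeling_space \<Gamma>') G'"
  have top: "topspace ?X = G" "topspace ?X' = G'"
    using topspace_labeling_space[OF fin] topspace_labeling_space[OF fin'] by (auto simp: G_def G'_def)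
  have proj: "continuous_map ?X (top_of_set {0..1}) (\<lambda>l. l e)" if "e \<in> edges \<Gamma>" for e
    unfolding labeling_space_def
    by (intro continuous_map_from_subtopology continuous_map_product_projection[OF that])
  have proj': "continuous_map ?X' (top_of_set {0..1}) (\<lambda>l. l e)" if "e \<in> edges \<Gamma>'" for e
    unfolding labeling_space_def
    by (intro continuous_map_from_subtopology continuous_map_product_projection[OF that])
  have "continuous_map ?X (product_topology (\<lambda>_. top_of_set {0..1}) (edges \<Gamma>')) r"
    unfolding continuous_map_componentwise
  proof (intro conjI ballI)
    fix e assume e: "e \<in> edges \<Gamma>'"
    then show "continuous_map ?X (top_of_set {0..1}) (\<lambda>l. r l e)"
      using proj[of e] EE by (auto simp: r_def)
  qed (auto simp: r_def)
  then have cr: "continuous_map ?X ?X' r"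
    unfolding labeling_space_def[of \<Gamma>'] using rG G'_labels top
    by (auto simp: continuous_map_in_subtopology)
  have "continuous_map ?X' (product_topology (\<lambda>_. top_of_set {0..1}) (edges \<Gamma>)) q"
    unfolding continuous_map_componentwise
  proof (intro conjI ballI)
    fix e assume e: "e \<in> edges \<Gamma>"
    show "continuous_map ?X' (top_of_set {0..1}) (\<lambda>l. q l e)"
    proof (cases "e \<in> edges \<Gamma>'")
      case True
      then show ?thesis using proj'[OF True] e by (simp add: q_def)
    next
      case False
      then show ?thesis using e dimer_labeling_range[OF fin l0 e] by (simp add: q_def)
    qed
  qed (auto simp: q_def)
  then have cq: "continuous_map ?X' ?X q"
    unfolding labeling_space_def[of \<Gamma>] using qG G_labels top
    by (auto simp: continuous_map_in_subtopology)
  have "homeomorphic_maps ?X ?X' r q"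
    unfolding homeomorphic_maps_def top using cr cq qr rq by blast
  then have "?X homeomorphic_space ?X'" unfolding homeomorphic_space_def by blast
  then show ?thesis
    using labeling_space0_eq[OF fin'] by (simp add: G_def G'_def \<Gamma>'_def)
qed

lemma path_connected_labeling_space0:
  "path_connected_space (subtopology (labeling_space \<Gamma>) (labeling_space0 \<Gamma>))"
proof (cases "dimer_coverings \<Gamma> = {}")
  case True
  then show ?thesis by (simp add: labeling_space0_def path_connected_space_topspace_empty)
next
  case False
  have "labeling_space0 \<Gamma> \<in> path_components_of (labeling_space \<Gamma>)"
    using theI'[OF labeling_space0_unique[OF fin False]] False by (simp add: labeling_space0_def)
  then show ?thesis using path_connectedin_path_components_of path_connectedin_def by blast
qed

end

text \<open>The labelings with the same odd cycles as a given one form a path-connected set, by comparison with the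
  subgraph.  The set of odd cycles is constant on path components, so this set is the whole component.\<close>

lemma path_component_homeomorphic_dimer_complex:
  assumes fin: "finite_mgraph \<Gamma>" and C: "C \<in> path_components_of (labeling_space \<Gamma>)"
  shows "\<exists>\<Gamma>'. subgraph \<Gamma>' \<Gamma> \<and> subtopology (labeling_space \<Gamma>) C homeomorphic_space dimer_complex \<Gamma>'"
proof -
  let ?X = "labeling_space \<Gamma>"
  obtain l0 where l0: "l0 \<in> topspace ?X" and C_eq: "C = Collect (path_component_of ?X l0)"
    using C unfolding path_components_of_def by blast
  have l0L: "l0 \<in> dimer_labelings \<Gamma>" using l0 topspace_labeling_space[OF fin] by simp
  define Om where "Om = odd_cycles_of \<Gamma> l0"
  define G where "G = {l \<in> dimer_labelings \<Gamma>. odd_cycles_of \<Gamma> l = Om}"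
  let ?D = "delete_cycles \<Gamma> Om"
  have fin': "finite_mgraph ?D" by (rule finite_mgraph_delete_cycles[OF fin])
  have hom: "subtopology ?X G homeomorphic_space subtopology (labeling_space ?D) (labeling_space0 ?D)"
    unfolding G_def by (rule odd_cycle_component_homeomorphic[OF fin l0L Om_def])
  have "path_connected_space (subtopology ?X G)"
    using path_connected_labeling_space0[OF fin'] homeomorphic_path_connected_space[OF hom] by blast
  then have "path_connectedin ?X G"
    using topspace_labeling_space[OF fin] by (auto simp: path_connectedin_def G_def)
  moreover have "l0 \<in> G" using l0L by (simp add: G_def Om_def)
  ultimately have "G \<subseteq> C" unfolding C_eq by (rule path_component_of_maximal)
  moreover have "C \<subseteq> G"
  proof
    fix l assume "l \<in> C"
    then have p: "path_component_of ?X l0 l" by (simp add: C_eq)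
    then have "l \<in> dimer_labelings \<Gamma>"
      using path_component_of_equiv[of ?X l0 l] topspace_labeling_space[OF fin] by blast
    then show "l \<in> G" using path_component_odd_cycles_of[OF fin p] by (simp add: G_def Om_def)
  qed
  ultimately have "C = G" by blast
  then have "subtopology ?X C homeomorphic_space dimer_complex ?D"
    using homeomorphic_space_trans[OF hom labeling_space0_homeomorphic_dimer_complex[OF fin']] by simp
  then show ?thesis using subgraph_delete_cycles[OF fin] by blast
qed

theorem theorem9p6:
  fixes \<Gamma> :: "('v, 'e) mgraph"
  assumes "finite_mgraph \<Gamma>"
  shows "subtopology (labeling_space \<Gamma>) (labeling_space0 \<Gamma>) homeomorphic_space dimer_complex \<Gamma> \<and>
         (\<forall>C\<in>path_components_of (labeling_space \<Gamma>) - {labeling_space0 \<Gamma>}.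
            \<exists>\<Gamma>'. subgraph \<Gamma>' \<Gamma> \<and>
                 subtopology (labeling_space \<Gamma>) C homeomorphic_space dimer_complex \<Gamma>')"
  using labeling_space0_homeomorphic_dimer_complex[OF assms]
    path_component_homeomorphic_dimer_complex[OF assms] by blast

end
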